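(* Let $k_1,k_2\ge0$. For $D\in\mathbb{D}_{\mathrm{ns}}(k)$ and $p=\gamma_{\mathrm{ns}}(k)(D)_{11}\in S(\mathfrak{h})=\mathbb{C}[\xi]$, we have $D=\beta_{\mathrm{ns}}(\Gamma_*(p(D_k)))$, and $$D\,P(\lambda,k)=p(\widetilde{\lambda})\,P(\lambda,k),\qquad\lambda\in P=\mathbb{Z}\epsilon,$$ where $\widetilde{n\epsilon}=n+\rho(k)$ for $n>0$ and $\widetilde{n\epsilon}=n-\rho(k)$ for $n\le0$.
   Context: Let $k=(k_1,k_2)$, $\rho(k)=\frac12(k_1+2k_2)$. On $\mathbb{C}[z^{\pm1}]$ consider the inner product $(f,g)_k=\int_{S^1}\overline{f(z)}g(z)\delta_k(z)\frac{dz}{iz}$, $\delta_k(z)=(1-(z+z^{-1})/2)^{k_1}(1-(z^2+z^{-2})/2)^{k_2}$. The non-symmetric Jacobi polynomials $E(n\epsilon,k)=E(n,k)=z^n+$ (combination of earlier monomials), $n\in\mathbb{Z}$, are obtained by Gram–Schmidt from the ordered basis $(1,z,z^{-1},z^2,z^{-2},\dots)$. Put $P(\lambda,k)=(E(\lambda,k)(z),E(\lambda,k)(z^{-1}))^T$. Write $z=e^\epsilon$, $\partial_\xi=z\,d/dz$; $\mathbb{Z}_2=\{1,s\}$ with $s(e^{n\epsilon})=e^{-n\epsilon}$. $S(\mathfrak{h})=\mathbb{C}[\xi]$. $\mathfrak{R}$ is the unital algebra generated by $(1-e^{-\epsilon})^{-1}$ and $(1-e^{-2\epsilon})^{-1}$;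 $\mathbb{D}_{\mathfrak{R}}=\mathfrak{R}\otimes\mathbb{C}[\partial_\xi]$ with $s(f\otimes p(\partial_\xi))=s(f)\otimes p(-\partial_\xi)$; $\mathbb{D}R_{\mathfrak{R}}=\mathbb{D}_{\mathfrak{R}}\otimes\mathbb{C}[\mathbb{Z}_2]$ is the algebra of differential-reflection operators. It contains the Cherednik operator $$D_k=\partial_\xi+\frac{k_1}{1-e^{-\epsilon}}(1-s)+\frac{2k_2}{1-e^{-2\epsilon}}(1-s)-\rho(k).$$ For $\mathcal{D}\in\mathbb{D}R_{\mathfrak{R}}$, $\Gamma_*(\mathcal{D})=\mathrm{diag}(\mathcal{D},s\mathcal{D}s)$, and $\beta_{\mathrm{ns}}$ replaces each reflection on the right by a matrix: $D\otimes w\otimes A\mapsto D\otimes A\pi(w^{-1})$, with $\pi(s)=\begin{pmatrix}0 & 1 \\ 1 & 0\end{pmatrix}$. Explicitly, if $\mathcal{D}=A+Bs$ with $A,B\in\mathbb{D}_{\mathfrak{R}}$, then $$\beta_{\mathrm{ns}}(\Gamma_*(\mathcal{D}))=\begin{pmatrix}A & B \\ s(B) & s(A)\end{pmatrix}.$$ Put $\widetilde{D}_k=\beta_{\mathrm{ns}}(\Gamma_*(D_k))$. $\mathbb{Z}_2$ acts on $\mathbb{D}_{\mathfrak{R}}\otimes\mathbb{M}_2$ ($\mathbb{M}_2$ = complex $2\times2$ matrices) by $s(D\otimes A)=s(D)\otimes\pi(s)A\pi(s)^{-1}$, and $\mathbb{D}_{\mathrm{ns}}(k)$ is the commutant of $\widetilde{D}_k$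 in the invariants $(\mathbb{D}_{\mathfrak{R}}\otimes\mathbb{M}_2)^{\mathbb{Z}_2}$. $\gamma(k):\mathbb{D}_{\mathfrak{R}}\to S(\mathfrak{h})$ is the unique algebra homomorphism with $(1-e^{-\epsilon})^{-1}\mapsto1$, $(1-e^{-2\epsilon})^{-1}\mapsto1$, $\partial_\xi\mapsto\xi-\rho(k)$, and $\gamma_{\mathrm{ns}}(k)$ is $\gamma(k)$ applied entrywise on $\mathbb{D}_{\mathfrak{R}}\otimes\mathbb{M}_2$. *)

theory Defs
  imports
    "HOL-Analysis.Analysis"
    "HOL-Complex_Analysis.Contour_Integration"
    "HOL-Computational_Algebra.Polynomial_Factorial"
    "HOL-Library.Poly_Mapping"
begin

section \<open>The field of rational functions in z\<close>

text \<open>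
  The algebra \<open>\<RR>\<close> of coefficient functions is realised inside the field of rational functions
  in \<open>z = e\<^sup>\<epsilon>\<close>, on which the Euler derivation and the reflection both act.
\<close>

type_synonym ratfun = "complex poly fract"

definition rconst :: "complex \<Rightarrow> ratfun" where
  "rconst c = to_fract [:c:]"

definition rZ :: ratfun where
  "rZ = to_fract [:0, 1:]"

definition frac_rep :: "ratfun \<Rightarrow> complex poly \<times> complex poly" where
  "frac_rep f = (SOME (a, b). b \<noteq> 0 \<and> f = Fract a b)"

lemma frac_rep: "snd (frac_rep f) \<noteq> 0" "Fract (fst (frac_rep f)) (snd (frac_rep f)) = f"
proof -
  have "\<exists>x. case x of (a, b) \<Rightarrow> b \<noteq> 0 \<and> f = Fract a b" by (cases f) auto
  then have "case frac_rep f of (a, b) \<Rightarrow> b \<noteq> 0 \<and> f = Fract a b"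
    unfolding frac_rep_def by (rule someI_ex)
  then show "snd (frac_rep f) \<noteq> 0" "Fract (fst (frac_rep f)) (snd (frac_rep f)) = f"
    by (auto simp: case_prod_unfold)
qed

text \<open>Neither \<open>euler\<close> nor \<open>rflip\<close> depends on the chosen fraction; see \<open>euler_Fract\<close> and \<open>rflip_Fract\<close>.\<close>

definition euler :: "ratfun \<Rightarrow> ratfun" where  \<comment> \<open>\<open>z d/dz\<close>\<close>
  "euler f = (case frac_rep f of (a, b) \<Rightarrow>
     Fract ([:0, 1:] * (pderiv a * b - a * pderiv b)) (b * b))"

definition subst_inv :: "complex poly \<Rightarrow> ratfun" where  \<comment> \<open>\<open>p(z\<^sup>-\<^sup>1)\<close>\<close>
  "subst_inv p = poly (map_poly rconst p) (inverse rZ)"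

definition rflip :: "ratfun \<Rightarrow> ratfun" where  \<comment> \<open>\<open>f(z) \<mapsto> f(z\<^sup>-\<^sup>1)\<close>\<close>
  "rflip f = (case frac_rep f of (a, b) \<Rightarrow> subst_inv a / subst_inv b)"

lemma rconst_simps [simp]:
  "rconst 0 = 0" "rconst 1 = 1" "rconst (a + b) = rconst a + rconst b"
  "rconst (a * b) = rconst a * rconst b" "rconst (- a) = - rconst a"
  "rconst (a - b) = rconst a - rconst b" "rconst a = 0 \<longleftrightarrow> a = 0"
proof -
  show "rconst (a + b) = rconst a + rconst b"
    unfolding rconst_def by (simp flip: to_fract_add)
  show "rconst (a * b) = rconst a * rconst b"
    unfolding rconst_def by (simp flip: to_fract_mult)
  show "rconst (- a) = - rconst a"
    unfolding rconst_def by (simp flip: to_fract_uminus)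
  show "rconst (a - b) = rconst a - rconst b"
    unfolding rconst_def by (simp flip: to_fract_diff)
qed (auto simp: rconst_def simp flip: one_pCons)

lemma rZ_neq_0 [simp]: "rZ \<noteq> 0"
  by (simp add: rZ_def)

lemma to_fract_pCons: "to_fract (pCons a p) = rconst a + rZ * to_fract p"
proof -
  have "pCons a p = [:a:] + [:0, 1:] * p" by simp
  then show ?thesis unfolding rconst_def rZ_def by (metis to_fract_add to_fract_mult)
qed

lemma euler_Fract:
  assumes nz: "b \<noteq> 0"
  shows "euler (Fract a b) = Fract ([:0, 1:] * (pderiv a * b - a * pderiv b)) (b * b)"
proof -
  obtain c d where cd: "frac_rep (Fract a b) = (c, d)" by (cases "frac_rep (Fract a b)")
  have nz': "d \<noteq> 0" using frac_rep(1)[of "Fract a b"] cd by simp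
  have "Fract a b = Fract c d"
    using frac_rep(2)[of "Fract a b"] cd by simp
  then have eq: "a * d = c * b" using nz nz' by (simp add: eq_fract)
  have d: "pderiv a * d + a * pderiv d = pderiv c * b + c * pderiv b"
    using arg_cong[OF eq, of pderiv] by (simp add: pderiv_mult algebra_simps)
  have "(pderiv a * b - a * pderiv b) * (d * d) = (pderiv c * d - c * pderiv d) * (b * b)"
    using eq d by algebra
  then have "[:0, 1:] * (pderiv a * b - a * pderiv b) * (d * d)
      = [:0, 1:] * (pderiv c * d - c * pderiv d) * (b * b)"
    by (simp only: mult.assoc)
  then show ?thesis using nz nz' by (simp only: euler_def cd prod.case) (simp add: eq_fract)
qed

lemma euler_add [simp]: "euler (f + g) = euler f + euler g"
proof (cases f, cases g)
  fix a b c d assume *: "f = Fract a b" "b \<noteq> 0" "g = Fract c d" "d \<noteq> 0"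
  show ?thesis unfolding * using *(2,4)
    by (simp add: euler_Fract eq_fract pderiv_mult pderiv_add del: mult_pCons_left mult_pCons_right) algebra
qed

lemma euler_mult: "euler (f * g) = euler f * g + f * euler g"
proof (cases f, cases g)
  fix a b c d assume *: "f = Fract a b" "b \<noteq> 0" "g = Fract c d" "d \<noteq> 0"
  show ?thesis unfolding * using *(2,4)
    by (simp add: euler_Fract eq_fract pderiv_mult pderiv_add del: mult_pCons_left mult_pCons_right) algebra
qed

lemma euler_rconst [simp]: "euler (rconst c) = 0"
  unfolding rconst_def to_fract_def by (simp add: euler_Fract pderiv_pCons eq_fract Zero_fract_def)

lemma euler_rZ: "euler rZ = rZ"
  unfolding rZ_def to_fract_def by (simp add: euler_Fract pderiv_pCons)

lemma euler_simps [simp]: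
  "euler 0 = 0" "euler 1 = 0" "euler (- f) = - euler f" "euler (f - g) = euler f - euler g"
proof -
  show 0: "euler 0 = 0" using euler_rconst[of 0] by simp
  show "euler 1 = 0" using euler_rconst[of 1] by simp
  have m: "euler (- h) = - euler h" for h
    using euler_add[of h "- h"] 0 by (simp add: eq_neg_iff_add_eq_0 add.commute)
  show "euler (- f) = - euler f" by (rule m)
  show "euler (f - g) = euler f - euler g" using euler_add[of f "- g"] m by simp
qed

lemma euler_inverse: "f \<noteq> 0 \<Longrightarrow> euler (inverse f) = - euler f / (f * f)"
proof -
  assume f: "f \<noteq> 0"
  have "euler (f * inverse f) = 0" using f by simp
  then have "euler f * inverse f + f * euler (inverse f) = 0" by (simp add: euler_mult)
  then show ?thesis using f by (simp add: field_simps eq_neg_iff_add_eq_0)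
qed

lemma euler_divide: "g \<noteq> 0 \<Longrightarrow> euler (f / g) = (euler f * g - f * euler g) / (g * g)"
  by (simp add: divide_inverse euler_mult euler_inverse) (simp add: field_simps)

lemma euler_sum: "euler (sum f A) = (\<Sum>x\<in>A. euler (f x))"
  by (induction A rule: infinite_finite_induct) auto

lemma subst_inv_0 [simp]: "subst_inv 0 = 0"
  by (simp add: subst_inv_def)

lemma subst_inv_pCons [simp]: "subst_inv (pCons a p) = rconst a + inverse rZ * subst_inv p"
  by (simp add: subst_inv_def map_poly_pCons)

lemma subst_inv_1 [simp]: "subst_inv 1 = 1"
  by (simp add: one_pCons)

lemma subst_inv_add [simp]: "subst_inv (p + q) = subst_inv p + subst_inv q"
proof (induction p arbitrary: q)
  case (pCons a p)
  then show ?case by (cases q) (simp add: algebra_simps)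
qed simp

lemma subst_inv_smult [simp]: "subst_inv (smult a p) = rconst a * subst_inv p"
  by (induction p) (auto simp: algebra_simps)

lemma subst_inv_mult [simp]: "subst_inv (p * q) = subst_inv p * subst_inv q"
  by (induction p) (auto simp: algebra_simps)

lemma poly_rconst_rZ: "poly (map_poly rconst p) rZ = to_fract p"
  by (induction p) (auto simp: map_poly_pCons to_fract_pCons)

lemma subst_inv_eq_0_iff [simp]: "subst_inv p = 0 \<longleftrightarrow> p = 0"
proof
  assume *: "subst_inv p = 0"
  define P where "P = map_poly rconst p"
  have "poly (reflect_poly P) rZ = rZ ^ degree P * poly P (inverse rZ)"
    by (rule poly_reflect_poly_nz) simp
  also have "\<dots> = 0" using * by (simp add: subst_inv_def P_def)
  finally have "poly (reflect_poly P) rZ = 0" .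
  moreover have "reflect_poly P = map_poly rconst (reflect_poly p)"
    by (rule poly_eqI) (auto simp: P_def coeff_reflect_poly coeff_map_poly degree_map_poly)
  ultimately show "p = 0" by (simp add: poly_rconst_rZ)
qed simp

lemma rflip_Fract: "b \<noteq> 0 \<Longrightarrow> rflip (Fract a b) = subst_inv a / subst_inv b"
proof -
  assume b: "b \<noteq> 0"
  obtain c d where cd: "frac_rep (Fract a b) = (c, d)" by (cases "frac_rep (Fract a b)")
  have d: "d \<noteq> 0" using frac_rep(1)[of "Fract a b"] cd by simp
  have "Fract a b = Fract c d"
    using frac_rep(2)[of "Fract a b"] cd by simp
  then have "a * d = c * b" using b d by (simp add: eq_fract)
  then have "subst_inv a * subst_inv d = subst_inv c * subst_inv b" by (metis subst_inv_mult)
  then show ?thesis using b d by (simp add: rflip_def cd frac_eq_eq)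
qed

lemma rflip_to_fract: "rflip (to_fract p) = subst_inv p"
  by (simp add: to_fract_def rflip_Fract)

lemma rflip_add [simp]: "rflip (f + g) = rflip f + rflip g"
proof (cases f, cases g)
  fix a b c d assume *: "f = Fract a b" "b \<noteq> 0" "g = Fract c d" "d \<noteq> 0"
  then show ?thesis by (simp add: rflip_Fract field_simps)
qed

lemma rflip_mult [simp]: "rflip (f * g) = rflip f * rflip g"
proof (cases f, cases g)
  fix a b c d assume *: "f = Fract a b" "b \<noteq> 0" "g = Fract c d" "d \<noteq> 0"
  then show ?thesis by (simp add: rflip_Fract field_simps)
qed

lemma rflip_rconst [simp]: "rflip (rconst c) = rconst c"
  by (simp add: rconst_def rflip_to_fract)

lemma rflip_rZ [simp]: "rflip rZ = inverse rZ"
  unfolding rZ_def rflip_to_fract by (simp add: rZ_def)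

lemma rflip_simps [simp]:
  "rflip 0 = 0" "rflip 1 = 1" "rflip (- f) = - rflip f" "rflip (f - g) = rflip f - rflip g"
proof -
  show 0: "rflip 0 = 0" using rflip_rconst[of 0] by simp
  show "rflip 1 = 1" using rflip_rconst[of 1] by simp
  have m: "rflip (- h) = - rflip h" for h
    using rflip_add[of h "- h"] 0 by (simp add: eq_neg_iff_add_eq_0 add.commute)
  show "rflip (- f) = - rflip f" by (rule m)
  show "rflip (f - g) = rflip f - rflip g" using rflip_add[of f "- g"] m by simp
qed

lemma rflip_inverse [simp]: "rflip (inverse f) = inverse (rflip f)"
proof (cases "f = 0")
  case False
  then have "rflip f * rflip (inverse f) = 1" by (simp flip: rflip_mult)
  then show ?thesis by (metis inverse_unique)
qed simp

lemma rflip_divide [simp]: "rflip (f / g) = rflip f / rflip g"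
  by (simp add: divide_inverse)

lemma rflip_subst_inv [simp]: "rflip (subst_inv p) = to_fract p"
  by (induction p) (auto simp: to_fract_pCons)

lemma rflip_refl [simp]: "rflip (rflip f) = f"
  by (cases f) (simp add: rflip_Fract, simp add: Fract_conv_to_fract)

lemma euler_subst_inv: "euler (subst_inv p) = - rflip (euler (to_fract p))"
proof (induction p)
  case (pCons a p)
  have "euler (inverse rZ) = - inverse rZ" by (simp add: inverse_eq_divide euler_divide euler_rZ)
  then show ?case using pCons
    by (simp add: to_fract_pCons euler_mult euler_rZ rflip_to_fract algebra_simps)
qed simp

lemma euler_rflip: "euler (rflip f) = - rflip (euler f)"
proof (cases f)
  case (Fract a b)
  have nz: "to_fract b \<noteq> 0" "subst_inv b \<noteq> 0" using Fract by auto
  have "euler (rflip f) = euler (subst_inv a / subst_inv b)" using Fract by (simp add: rflip_Fract)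
  also have "\<dots> = - rflip (euler (to_fract a / to_fract b))"
    using nz by (simp add: euler_divide euler_subst_inv rflip_to_fract) (simp add: field_simps)
  finally show ?thesis using Fract by (simp add: Fract_conv_to_fract)
qed


section \<open>The coefficient algebra and the differential operators over it\<close>

definition u1 :: ratfun where "u1 = inverse (1 - inverse rZ)"  \<comment> \<open>\<open>(1 - e\<^sup>-\<^sup>\<epsilon>)\<^sup>-\<^sup>1\<close>\<close>
definition u2 :: ratfun where "u2 = inverse (1 - inverse rZ ^ 2)"  \<comment> \<open>\<open>(1 - e\<^sup>-\<^sup>2\<^sup>\<epsilon>)\<^sup>-\<^sup>1\<close>\<close>

inductive_set RR :: "ratfun set" where
  const: "rconst c \<in> RR"
| u1: "u1 \<in> RR"
| u2: "u2 \<in> RR"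
| add: "f \<in> RR \<Longrightarrow> g \<in> RR \<Longrightarrow> f + g \<in> RR"
| mult: "f \<in> RR \<Longrightarrow> g \<in> RR \<Longrightarrow> f * g \<in> RR"

lemma rZ_neq_1: "rZ \<noteq> 1" "rZ\<^sup>2 \<noteq> 1"
proof -
  show "rZ \<noteq> 1" unfolding rZ_def to_fract_1[symmetric] to_fract_eq_iff by (simp add: one_pCons)
  have "rZ\<^sup>2 = to_fract [:0, 0, 1:]" by (simp add: rZ_def power2_eq_square flip: to_fract_mult)
  then show "rZ\<^sup>2 \<noteq> 1" unfolding to_fract_1[symmetric] by (simp add: one_pCons)
qed

lemma RR_simps [simp, intro]:
  "0 \<in> RR" "1 \<in> RR" "f \<in> RR \<Longrightarrow> - f \<in> RR" "f \<in> RR \<Longrightarrow> g \<in> RR \<Longrightarrow> f - g \<in> RR"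
  "f \<in> RR \<Longrightarrow> g \<in> RR \<Longrightarrow> f + g \<in> RR" "f \<in> RR \<Longrightarrow> g \<in> RR \<Longrightarrow> f * g \<in> RR" "rconst c \<in> RR"
proof -
  have m: "h \<in> RR \<Longrightarrow> - h \<in> RR" for h using RR.mult[OF RR.const[of "-1"], of h] by simp
  show "f \<in> RR \<Longrightarrow> - f \<in> RR" by (rule m)
  show "f \<in> RR \<Longrightarrow> g \<in> RR \<Longrightarrow> f - g \<in> RR" using RR.add[of f "- g"] m[of g] by simp
qed (use RR.const[of 0] RR.const[of 1] RR.intros in auto)

lemma RR_sum [intro]: "(\<And>x. x \<in> A \<Longrightarrow> f x \<in> RR) \<Longrightarrow> sum f A \<in> RR"
  by (induction A rule: infinite_finite_induct) auto

lemma rflip_u: "rflip u1 = 1 - u1" "rflip u2 = 1 - u2"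
  using rZ_neq_1 by (auto simp: u1_def u2_def power2_eq_square field_simps)

lemma euler_u: "euler u1 = u1 - u1 * u1" "euler u2 = 2 * (u2 - u2 * u2)"
proof -
  have nz: "1 - inverse rZ \<noteq> 0" "1 - inverse rZ * inverse rZ \<noteq> 0"
    using rZ_neq_1 by (auto simp: power2_eq_square inverse_eq_divide field_simps)
  have e: "euler (inverse rZ) = - inverse rZ" by (simp add: inverse_eq_divide euler_divide euler_rZ)
  have "euler u1 = - inverse rZ / ((1 - inverse rZ) * (1 - inverse rZ))"
    using nz unfolding u1_def by (subst euler_inverse) (auto simp: e)
  also have "\<dots> = u1 - u1 * u1" using nz unfolding u1_def by (simp add: divide_simps) (simp add: algebra_simps)
  finally show "euler u1 = u1 - u1 * u1" .
  define w where "w = inverse rZ * inverse rZ"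
  have ew: "euler w = - 2 * w" unfolding w_def by (simp add: euler_mult e)
  have w: "1 - w \<noteq> 0" "u2 = inverse (1 - w)" using nz by (auto simp: w_def u2_def power2_eq_square)
  have "euler u2 = - 2 * w / ((1 - w) * (1 - w))"
    unfolding w(2) using w(1) by (subst euler_inverse) (auto simp: ew)
  also have "\<dots> = 2 * (u2 - u2 * u2)" using w(1) unfolding w(2) by (simp add: divide_simps)
  finally show "euler u2 = 2 * (u2 - u2 * u2)" .
qed

lemma RR_rflip [intro]: "f \<in> RR \<Longrightarrow> rflip f \<in> RR"
  by (induction rule: RR.induct) (auto simp: rflip_u intro: RR.intros)

lemma RR_2: "2 \<in> RR"
  using RR.add[of 1 1] by auto

lemma RR_euler [intro]: "f \<in> RR \<Longrightarrow> euler f \<in> RR"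
proof (induction rule: RR.induct)
  case u2
  show ?case unfolding euler_u by (intro RR_simps RR_2 RR.intros)
qed (auto simp: euler_u euler_mult intro: RR.intros)

text \<open>
  A differential operator \<open>\<Sum>\<^sub>i f\<^sub>i \<partial>\<^sub>\<xi>\<^sup>i\<close> is stored as the polynomial with coefficients \<open>f\<^sub>i\<close>, written on
  the left. Products are determined by \<open>\<partial>\<^sub>\<xi> f = f \<partial>\<^sub>\<xi> + z f'(z)\<close>; the operation \<open>dshift\<close> is left
  multiplication by \<open>\<partial>\<^sub>\<xi>\<close>.
\<close>

definition dshift :: "ratfun poly \<Rightarrow> ratfun poly" where
  "dshift q = map_poly euler q + pCons 0 q"

definition opmult :: "ratfun poly \<Rightarrow> ratfun poly \<Rightarrow> ratfun poly" where
  "opmult p q = (\<Sum>i\<le>degree p. smult (coeff p i) ((dshift ^^ i) q))"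

definition opact :: "ratfun poly \<Rightarrow> ratfun \<Rightarrow> ratfun" where
  "opact p f = (\<Sum>i\<le>degree p. coeff p i * (euler ^^ i) f)"

definition opflip :: "ratfun poly \<Rightarrow> ratfun poly" where
  "opflip p = pcompose (map_poly rflip p) [:0, - 1:]"

lemma coeff_dshift: "coeff (dshift q) i = euler (coeff q i) + (if i = 0 then 0 else coeff q (i - 1))"
  by (auto simp: dshift_def coeff_map_poly coeff_pCons split: nat.splits)

lemma coeff_opflip: "coeff (opflip p) i = (- 1) ^ i * rflip (coeff p i)"
proof -
  have "coeff (pcompose q [:0, - 1:]) i = (- 1) ^ i * coeff q i" for q :: "ratfun poly"
    by (induction q arbitrary: i) (auto simp: pcompose_pCons coeff_pCons split: nat.splits)
  then show ?thesis by (simp add: opflip_def coeff_map_poly)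
qed

lemma dshift_add [simp]: "dshift (p + q) = dshift p + dshift q"
  by (rule poly_eqI) (simp add: coeff_dshift)

lemma dshift_0 [simp]: "dshift 0 = 0"
  by (simp add: dshift_def)

lemma dshift_smult: "dshift (smult a q) = smult (euler a) q + smult a (dshift q)"
  by (rule poly_eqI) (simp add: coeff_dshift euler_mult algebra_simps)

lemma funpow_dshift_add: "(dshift ^^ i) (p + q) = (dshift ^^ i) p + (dshift ^^ i) q"
  by (induction i) auto

lemma funpow_dshift_0 [simp]: "(dshift ^^ i) 0 = 0"
  by (induction i) auto

lemma opmult_bound:
  "degree p \<le> n \<Longrightarrow> opmult p q = (\<Sum>i\<le>n. smult (coeff p i) ((dshift ^^ i) q))"
  unfolding opmult_def by (rule sum.mono_neutral_left) (auto simp: coeff_eq_0)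

lemma opmult_add_left: "opmult (p + p') q = opmult p q + opmult p' q"
proof -
  define n where "n = max (degree p) (degree p')"
  have "degree (p + p') \<le> n" by (simp add: n_def degree_add_le_max)
  then show ?thesis
    by (simp add: opmult_bound[of _ n] n_def smult_add_left sum.distrib)
qed

lemma opmult_add_right: "opmult p (q + q') = opmult p q + opmult p q'"
  by (simp add: opmult_def funpow_dshift_add smult_add_right sum.distrib)

lemma opmult_0 [simp]: "opmult 0 q = 0" "opmult p 0 = 0"
  by (simp_all add: opmult_def)

lemma smult_sum_right: "smult a (\<Sum>x\<in>A. f x) = (\<Sum>x\<in>A. smult a (f x))"
  by (induction A rule: infinite_finite_induct) (auto simp: smult_add_right)

lemma opmult_smult_left: "opmult (smult a p) q = smult a (opmult p q)"
  by (simp add: opmult_bound[of "smult a p" "degree p"] degree_smult_le opmult_def smult_sum_right)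

lemma opmult_pCons: "opmult (pCons a p) q = smult a q + opmult p (dshift q)"
proof -
  have "opmult (pCons a p) q = (\<Sum>i\<le>Suc (degree p). smult (coeff (pCons a p) i) ((dshift ^^ i) q))"
    by (rule opmult_bound) (simp add: degree_pCons_le)
  also have "\<dots> = smult a q + (\<Sum>i\<le>degree p. smult (coeff p i) ((dshift ^^ Suc i) q))"
    by (subst sum.atMost_Suc_shift) simp
  finally show ?thesis by (simp add: opmult_def funpow_swap1)
qed

lemma dshift_pCons: "dshift (pCons a p) = pCons (euler a) (smult a 1 + dshift p)"
  by (rule poly_eqI) (auto simp: coeff_dshift coeff_pCons split: nat.splits)

lemma opmult_1 [simp]: "opmult 1 q = q" "opmult p 1 = p"
proof -
  show "opmult 1 q = q" by (simp add: opmult_def)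
  have *: "(dshift ^^ i) 1 = monom 1 i" for i
    by (induction i) (auto intro!: poly_eqI simp: coeff_dshift simp flip: monom_0)
  show "opmult p 1 = p"
    using poly_as_sum_of_monoms[of p] by (simp add: opmult_def * smult_monom)
qed

lemma dshift_opmult: "dshift (opmult p q) = opmult (dshift p) q"
proof (induction p arbitrary: q)
  case (pCons a p)
  then show ?case
    by (simp add: opmult_pCons dshift_pCons dshift_smult opmult_add_left opmult_smult_left)
qed simp

lemma opmult_assoc: "opmult (opmult p q) r = opmult p (opmult q r)"
proof (induction p arbitrary: q)
  case (pCons a p)
  then show ?case by (simp add: opmult_pCons opmult_add_left opmult_smult_left dshift_opmult)
qed simp

lemma opact_bound: "degree p \<le> n \<Longrightarrow> opact p f = (\<Sum>i\<le>n. coeff p i * (euler ^^ i) f)"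
  unfolding opact_def by (rule sum.mono_neutral_left) (auto simp: coeff_eq_0)

lemma opact_add: "opact (p + q) f = opact p f + opact q f"
proof -
  define n where "n = max (degree p) (degree q)"
  have "degree (p + q) \<le> n" by (simp add: n_def degree_add_le_max)
  then show ?thesis by (simp add: opact_bound[of _ n] n_def algebra_simps sum.distrib)
qed

lemma opact_0 [simp]: "opact 0 f = 0"
  by (simp add: opact_def)

lemma opact_smult: "opact (smult a p) f = a * opact p f"
  by (simp add: opact_bound[of "smult a p" "degree p"] degree_smult_le opact_def sum_distrib_left
      mult.assoc)

lemma opact_pCons: "opact (pCons a p) f = a * f + opact p (euler f)"
proof -
  have "opact (pCons a p) f = (\<Sum>i\<le>Suc (degree p). coeff (pCons a p) i * (euler ^^ i) f)"
    by (rule opact_bound) (simp add: degree_pCons_le)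
  also have "\<dots> = a * f + (\<Sum>i\<le>degree p. coeff p i * (euler ^^ Suc i) f)"
    by (subst sum.atMost_Suc_shift) simp
  finally show ?thesis by (simp add: opact_def funpow_swap1)
qed

lemma opact_dshift: "opact (dshift p) f = euler (opact p f)"
proof (induction p arbitrary: f)
  case (pCons a p)
  have "opact 1 h = h" for h by (simp add: opact_def)
  with pCons show ?case
    by (simp add: opact_pCons dshift_pCons opact_add opact_smult euler_mult algebra_simps)
qed simp

lemma opact_opmult: "opact (opmult p q) f = opact p (opact q f)"
proof (induction p arbitrary: q)
  case (pCons a p)
  then show ?case by (simp add: opmult_pCons opact_add opact_smult opact_dshift opact_pCons)
qed simp

lemma opflip_add: "opflip (p + q) = opflip p + opflip q"
  by (rule poly_eqI) (simp add: coeff_opflip algebra_simps)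

lemma opflip_smult: "opflip (smult a p) = smult (rflip a) (opflip p)"
  by (rule poly_eqI) (simp add: coeff_opflip algebra_simps)

lemma opflip_dshift: "opflip (dshift p) = - dshift (opflip p)"
proof (rule poly_eqI)
  fix i
  have e: "euler ((- 1) ^ i * f) = (- 1) ^ i * euler f" for f i
    by (cases "even i") auto
  show "coeff (opflip (dshift p)) i = coeff (- dshift (opflip p)) i"
    by (cases i) (auto simp: coeff_opflip coeff_dshift e euler_rflip algebra_simps)
qed

lemma opflip_0 [simp]: "opflip 0 = 0"
  by (rule poly_eqI) (simp add: coeff_opflip)

lemma opflip_pCons: "opflip (pCons a p) = pCons (rflip a) (- opflip p)"
  by (rule poly_eqI) (auto simp: coeff_opflip coeff_pCons split: nat.splits)

lemma opmult_minus: "opmult (- p) q = - opmult p q" "opmult p (- q) = - opmult p q"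
  using opmult_add_left[of p "- p" q] opmult_add_right[of p q "- q"]
  by (simp_all add: eq_neg_iff_add_eq_0 add.commute)

lemma opflip_opmult: "opflip (opmult p q) = opmult (opflip p) (opflip q)"
proof (induction p arbitrary: q)
  case (pCons a p)
  then show ?case
    by (simp add: opmult_pCons opflip_add opflip_smult opflip_pCons opflip_dshift opmult_minus)
qed simp

lemma opflip_opflip [simp]: "opflip (opflip p) = p"
proof (rule poly_eqI)
  fix i
  have "(- 1) ^ i * rflip ((- 1) ^ i * f) = rflip f" for f
    by (cases "even i") auto
  then show "coeff (opflip (opflip p)) i = coeff p i"
    by (cases "even i") (simp_all add: coeff_opflip)
qed

definition rcoeffs :: "ratfun poly \<Rightarrow> bool" where
  "rcoeffs p \<longleftrightarrow> (\<forall>i. coeff p i \<in> RR)"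

lemma rcoeffs_simps [simp]:
  "rcoeffs 0" "rcoeffs 1" "rcoeffs (pCons a p) \<longleftrightarrow> a \<in> RR \<and> rcoeffs p"
  "rcoeffs p \<Longrightarrow> rcoeffs q \<Longrightarrow> rcoeffs (p + q)" "rcoeffs p \<Longrightarrow> rcoeffs q \<Longrightarrow> rcoeffs (p - q)"
  "rcoeffs p \<Longrightarrow> rcoeffs (- p)" "a \<in> RR \<Longrightarrow> rcoeffs p \<Longrightarrow> rcoeffs (smult a p)"
  by (auto simp: rcoeffs_def coeff_pCons split: nat.splits)

lemma rcoeffs_dshift [simp]: "rcoeffs p \<Longrightarrow> rcoeffs (dshift p)"
  by (auto simp: rcoeffs_def coeff_dshift)

lemma rcoeffs_opmult [simp]: "rcoeffs p \<Longrightarrow> rcoeffs q \<Longrightarrow> rcoeffs (opmult p q)"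
  by (induction p arbitrary: q) (auto simp: opmult_pCons)

lemma rcoeffs_opflip [simp]: "rcoeffs p \<Longrightarrow> rcoeffs (opflip p)"
  by (induction p) (auto simp: opflip_pCons)

typedef diffop = "{p :: ratfun poly. rcoeffs p}" morphisms op_poly Abs_diffop
  by (rule exI[of _ 0]) simp

setup_lifting type_definition_diffop

instantiation diffop :: ring_1
begin
lift_definition zero_diffop :: diffop is 0 by simp
lift_definition one_diffop :: diffop is 1 by simp
lift_definition plus_diffop :: "diffop \<Rightarrow> diffop \<Rightarrow> diffop" is "(+)" by simp
lift_definition minus_diffop :: "diffop \<Rightarrow> diffop \<Rightarrow> diffop" is "(-)" by simp
lift_definition uminus_diffop :: "diffop \<Rightarrow> diffop" is uminus by simp
lift_definition times_diffop :: "diffop \<Rightarrow> diffop \<Rightarrow> diffop" is opmult by simp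
instance
  by standard (transfer; simp add: opmult_assoc opmult_add_left opmult_add_right)+
end

lift_definition dconst :: "complex \<Rightarrow> diffop" is "\<lambda>c. [:rconst c:]" by simp
lift_definition du1 :: diffop is "[:u1:]" by (simp add: RR.u1)
lift_definition du2 :: diffop is "[:u2:]" by (simp add: RR.u2)
lift_definition dxi :: diffop is "[:0, 1:]" by simp  \<comment> \<open>\<open>\<partial>\<^sub>\<xi>\<close>\<close>
lift_definition dact :: "diffop \<Rightarrow> ratfun \<Rightarrow> ratfun" is opact .
lift_definition dflip :: "diffop \<Rightarrow> diffop" is opflip by simp  \<comment> \<open>\<open>s(f \<otimes> p(\<partial>\<^sub>\<xi>)) = s(f) \<otimes> p(-\<partial>\<^sub>\<xi>)\<close>\<close>

lemma dact_mult: "dact (P * Q) f = dact P (dact Q f)"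
  by transfer (rule opact_opmult)

lemma dact_generators:
  "dact (dconst c) f = rconst c * f" "dact du1 f = u1 * f" "dact du2 f = u2 * f"
  "dact dxi f = euler f"
  by (transfer; simp add: opact_def)+

lemma dflip_simps [simp]:
  "dflip 0 = 0" "dflip 1 = 1" "dflip (P + Q) = dflip P + dflip Q"
  "dflip (P * Q) = dflip P * dflip Q" "dflip (dflip P) = P"
  by (transfer; simp add: opflip_add opflip_opmult opflip_pCons one_pCons)+


section \<open>Differential-reflection operators\<close>

datatype dreflop = DRefl (dpart: diffop) (rpart: diffop)  \<comment> \<open>\<open>A + B s\<close>\<close>

instantiation dreflop :: ring_1
begin
definition "0 = DRefl 0 0"
definition "1 = DRefl 1 0"
definition "X + Y = DRefl (dpart X + dpart Y) (rpart X + rpart Y)"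
definition "X - Y = DRefl (dpart X - dpart Y) (rpart X - rpart Y)"
definition "- X = DRefl (- dpart X) (- rpart X)"
definition "X * Y = DRefl (dpart X * dpart Y + rpart X * dflip (rpart Y))
                      (dpart X * rpart Y + rpart X * dflip (dpart Y))"
instance
  by standard (auto simp: zero_dreflop_def one_dreflop_def plus_dreflop_def minus_dreflop_def
      uminus_dreflop_def times_dreflop_def algebra_simps)
end

abbreviation of_diffop :: "diffop \<Rightarrow> dreflop" where
  "of_diffop A \<equiv> DRefl A 0"

definition rs :: dreflop where  \<comment> \<open>the reflection \<open>s\<close>\<close>
  "rs = DRefl 0 1"

definition rho :: "real \<Rightarrow> real \<Rightarrow> real" where
  "rho k1 k2 = (k1 + 2 * k2) / 2"

definition cherednik :: "real \<Rightarrow> real \<Rightarrow> dreflop" where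
  "cherednik k1 k2 =
     of_diffop dxi + of_diffop (dconst k1 * du1) * (1 - rs)
     + of_diffop (dconst (2 * k2) * du2) * (1 - rs) - of_diffop (dconst (rho k1 k2))"

definition poly_op :: "complex poly \<Rightarrow> dreflop \<Rightarrow> dreflop" where  \<comment> \<open>\<open>p(X)\<close>\<close>
  "poly_op p X = (\<Sum>i\<le>degree p. of_diffop (dconst (coeff p i)) * X ^ i)"

text \<open>
  \<open>beta_ns\<close> replaces \<open>D \<otimes> w \<otimes> A\<close> by \<open>D \<otimes> A \<pi>(w\<^sup>-\<^sup>1)\<close>: the part without reflection is kept and the part
  with \<open>s\<close> is multiplied on the right by \<open>\<pi>(s)\<close>.
\<close>

definition pi_s :: "'a::{zero,one}^2^2" where
  "pi_s = vector [vector [0, 1], vector [1, 0]]"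

definition Gamma_star :: "dreflop \<Rightarrow> dreflop^2^2" where
  "Gamma_star X = vector [vector [X, 0], vector [0, rs * X * rs]]"

definition beta_ns :: "dreflop^2^2 \<Rightarrow> diffop^2^2" where
  "beta_ns M = (\<chi> i j. dpart (M $ i $ j)) + (\<chi> i j. rpart (M $ i $ j)) ** pi_s"

lemma beta_ns_Gamma_star:
  "beta_ns (Gamma_star (DRefl A B)) = vector [vector [A, B], vector [dflip B, dflip A]]"
  by (simp add: vec_eq_iff forall_2 beta_ns_def Gamma_star_def pi_s_def rs_def zero_dreflop_def
      times_dreflop_def matrix_matrix_mult_def sum_2)

definition mat_flip :: "diffop^2^2 \<Rightarrow> diffop^2^2" where  \<comment> \<open>the action of \<open>s\<close>; note \<open>\<pi>(s)\<^sup>-\<^sup>1 = \<pi>(s)\<close>\<close>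
  "mat_flip M = pi_s ** (\<chi> i j. dflip (M $ i $ j)) ** pi_s"

definition D_tilde :: "real \<Rightarrow> real \<Rightarrow> diffop^2^2" where
  "D_tilde k1 k2 = beta_ns (Gamma_star (cherednik k1 k2))"

definition D_ns :: "real \<Rightarrow> real \<Rightarrow> (diffop^2^2) set" where
  "D_ns k1 k2 = {M. mat_flip M = M \<and> M ** D_tilde k1 k2 = D_tilde k1 k2 ** M}"

definition mat_act :: "diffop^2^2 \<Rightarrow> ratfun^2 \<Rightarrow> ratfun^2" where
  "mat_act M v = (\<chi> i. \<Sum>j\<in>UNIV. dact (M $ i $ j) (v $ j))"


section \<open>The constant term homomorphism\<close>

text \<open>\<open>gamma\<close> is defined by its characterising property; \<open>ex1_gamma\<close> shows that this is legitimate.\<close>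

definition is_gamma :: "real \<Rightarrow> real \<Rightarrow> (diffop \<Rightarrow> complex poly) \<Rightarrow> bool" where
  "is_gamma k1 k2 g \<longleftrightarrow>
     g 1 = 1 \<and> (\<forall>P Q. g (P + Q) = g P + g Q) \<and> (\<forall>P Q. g (P * Q) = g P * g Q) \<and>
     (\<forall>c P. g (dconst c * P) = smult c (g P)) \<and>
     g du1 = 1 \<and> g du2 = 1 \<and> g dxi = [:- of_real (rho k1 k2), 1:]"

definition gamma :: "real \<Rightarrow> real \<Rightarrow> diffop \<Rightarrow> complex poly" where
  "gamma k1 k2 = (THE g. is_gamma k1 k2 g)"

text \<open>
  Existence: send \<open>f \<partial>\<^sub>\<xi>\<^sup>i\<close> to \<open>f(\<infinity>) (\<xi> - \<rho>)\<^sup>i\<close>, where the value at infinity is computed as the value at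
  the origin of \<open>f(z\<^sup>-\<^sup>1)\<close>.
\<close>

definition has_val0 :: "ratfun \<Rightarrow> complex \<Rightarrow> bool" where
  "has_val0 f c \<longleftrightarrow> (\<exists>a b. f = Fract a b \<and> poly b 0 \<noteq> 0 \<and> c = poly a 0 / poly b 0)"

definition val_inf :: "ratfun \<Rightarrow> complex" where
  "val_inf f = (THE c. has_val0 (rflip f) c)"

lemma has_val0I:
  "f = Fract a b \<Longrightarrow> poly b 0 \<noteq> 0 \<Longrightarrow> c = poly a 0 / poly b 0 \<Longrightarrow> has_val0 f c"
  unfolding has_val0_def by blast

lemma has_val0_unique:
  assumes "has_val0 f c" "has_val0 f d"
  shows "c = d"
proof -
  obtain a b a' b' where *: "f = Fract a b" "poly b 0 \<noteq> 0" "c = poly a 0 / poly b 0"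
    "f = Fract a' b'" "poly b' 0 \<noteq> 0" "d = poly a' 0 / poly b' 0"
    using assms unfolding has_val0_def by blast
  then have "b \<noteq> 0" "b' \<noteq> 0" by auto
  then have "a * b' = a' * b" using * eq_fract(1) by metis
  then have "poly a 0 * poly b' 0 = poly a' 0 * poly b 0" by (metis poly_mult)
  then show ?thesis using * by (simp add: frac_eq_eq)
qed

lemma has_val0_add:
  assumes "has_val0 f c" "has_val0 g d"
  shows "has_val0 (f + g) (c + d)"
proof -
  obtain a b a' b' where *: "f = Fract a b" "poly b 0 \<noteq> 0" "c = poly a 0 / poly b 0"
    "g = Fract a' b'" "poly b' 0 \<noteq> 0" "d = poly a' 0 / poly b' 0"
    using assms unfolding has_val0_def by blast
  then have "b \<noteq> 0" "b' \<noteq> 0" by auto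
  then have "f + g = Fract (a * b' + a' * b) (b * b')" using * by simp
  then show ?thesis by (rule has_val0I) (use * in \<open>simp_all add: add_frac_eq\<close>)
qed

lemma has_val0_mult:
  assumes "has_val0 f c" "has_val0 g d"
  shows "has_val0 (f * g) (c * d)"
proof -
  obtain a b a' b' where *: "f = Fract a b" "poly b 0 \<noteq> 0" "c = poly a 0 / poly b 0"
    "g = Fract a' b'" "poly b' 0 \<noteq> 0" "d = poly a' 0 / poly b' 0"
    using assms unfolding has_val0_def by blast
  then have "f * g = Fract (a * a') (b * b')" by simp
  then show ?thesis by (rule has_val0I) (use * in simp_all)
qed

lemma has_val0_euler:
  assumes "has_val0 f c"
  shows "has_val0 (euler f) 0"
proof -
  obtain a b where *: "f = Fract a b" "poly b 0 \<noteq> 0" using assms unfolding has_val0_def by blast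
  then have "b \<noteq> 0" by auto
  then have "euler f = Fract ([:0, 1:] * (pderiv a * b - a * pderiv b)) (b * b)"
    using * by (simp add: euler_Fract)
  then show ?thesis by (rule has_val0I) (use * in simp_all)
qed

lemma has_val0_minus: "has_val0 f c \<Longrightarrow> has_val0 (- f) (- c)"
  unfolding has_val0_def by (metis minus_fract minus_divide_left poly_minus)

lemma has_val0_rconst: "has_val0 (rconst c) c"
  unfolding rconst_def to_fract_def by (rule has_val0I[of _ "[:c:]" 1]) simp_all

lemma has_val0_rflip_u: "has_val0 (rflip u1) 1" "has_val0 (rflip u2) 1"
proof -
  have "rflip u1 = inverse (to_fract (1 - [:0, 1:]))"
    unfolding u1_def to_fract_diff to_fract_1 rZ_def[symmetric] by simp
  also have "\<dots> = Fract 1 (1 - [:0, 1:])" by (simp only: to_fract_def inverse_fract)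
  finally show "has_val0 (rflip u1) 1" by (rule has_val0I) simp_all
  have "rflip u2 = inverse (to_fract (1 - [:0, 1:] * [:0, 1:]))"
    unfolding u2_def to_fract_diff to_fract_mult to_fract_1 rZ_def[symmetric]
    by (simp add: power2_eq_square)
  also have "\<dots> = Fract 1 (1 - [:0, 1:] * [:0, 1:])" by (simp only: to_fract_def inverse_fract)
  finally show "has_val0 (rflip u2) 1" by (rule has_val0I) simp_all
qed

lemma val_infI: "has_val0 (rflip f) c \<Longrightarrow> val_inf f = c"
  unfolding val_inf_def using has_val0_unique by blast

lemma val_inf: "f \<in> RR \<Longrightarrow> has_val0 (rflip f) (val_inf f)"
proof -
  assume "f \<in> RR"
  then have "\<exists>c. has_val0 (rflip f) c"
    by induction (use has_val0_rconst has_val0_rflip_u has_val0_add has_val0_mult in \<open>auto, blast+\<close>)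
  then show ?thesis using val_infI by metis
qed

lemma val_inf_simps [simp]:
  "val_inf (rconst c) = c" "val_inf u1 = 1" "val_inf u2 = 1" "val_inf 0 = 0" "val_inf 1 = 1"
  "f \<in> RR \<Longrightarrow> g \<in> RR \<Longrightarrow> val_inf (f + g) = val_inf f + val_inf g"
  "f \<in> RR \<Longrightarrow> g \<in> RR \<Longrightarrow> val_inf (f * g) = val_inf f * val_inf g"
  "f \<in> RR \<Longrightarrow> val_inf (euler f) = 0"
proof -
  show c: "val_inf (rconst c) = c" for c
    by (rule val_infI) (simp add: has_val0_rconst)
  show "val_inf 0 = 0" "val_inf 1 = 1" using c[of 0] c[of 1] by simp_all
  show "val_inf u1 = 1" "val_inf u2 = 1" by (rule val_infI, rule has_val0_rflip_u)+
  show "f \<in> RR \<Longrightarrow> g \<in> RR \<Longrightarrow> val_inf (f + g) = val_inf f + val_inf g"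
    by (rule val_infI) (simp add: has_val0_add val_inf)
  show "f \<in> RR \<Longrightarrow> g \<in> RR \<Longrightarrow> val_inf (f * g) = val_inf f * val_inf g"
    by (rule val_infI) (simp add: has_val0_mult val_inf)
  assume f: "f \<in> RR"
  have "rflip (euler f) = - euler (rflip f)" by (simp add: euler_rflip)
  then have "has_val0 (rflip (euler f)) (- 0)"
    using has_val0_minus[OF has_val0_euler[OF val_inf[OF f]]] by simp
  then show "val_inf (euler f) = 0" using val_infI by fastforce
qed

definition opsymb :: "complex \<Rightarrow> ratfun poly \<Rightarrow> complex poly" where
  "opsymb r p = pcompose (map_poly val_inf p) [:- r, 1:]"

lemma opsymb_simps [simp]:
  "opsymb r 0 = 0"
  "opsymb r (pCons a p) = [:val_inf a:] + [:- r, 1:] * opsymb r p"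
  by (simp_all add: opsymb_def map_poly_pCons pcompose_pCons del: mult_pCons_left)

lemma opsymb_add: "rcoeffs p \<Longrightarrow> rcoeffs q \<Longrightarrow> opsymb r (p + q) = opsymb r p + opsymb r q"
proof (induction p arbitrary: q)
  case (pCons a p)
  then show ?case by (cases q) (simp add: distrib_left del: mult_pCons_left)
qed simp

lemma opsymb_smult: "a \<in> RR \<Longrightarrow> rcoeffs p \<Longrightarrow> opsymb r (smult a p) = smult (val_inf a) (opsymb r p)"
  by (induction p) (simp_all add: smult_add_right)

lemma opsymb_dshift: "rcoeffs p \<Longrightarrow> opsymb r (dshift p) = [:- r, 1:] * opsymb r p"
proof (induction p)
  case (pCons a p)
  then show ?case by (simp add: dshift_pCons opsymb_add del: mult_pCons_left)
qed simp

lemma opsymb_opmult: "rcoeffs p \<Longrightarrow> rcoeffs q \<Longrightarrow> opsymb r (opmult p q) = opsymb r p * opsymb r q"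
proof (induction p arbitrary: q)
  case (pCons a p)
  then have "opsymb r (opmult (pCons a p) q)
      = smult (val_inf a) (opsymb r q) + opsymb r p * ([:- r, 1:] * opsymb r q)"
    by (simp add: opmult_pCons opsymb_add opsymb_smult opsymb_dshift del: mult_pCons_left)
  also have "\<dots> = [:val_inf a:] * opsymb r q + [:- r, 1:] * opsymb r p * opsymb r q"
    by (simp only: mult.left_commute[of "opsymb r p"] mult.assoc) simp
  finally show ?case by (simp only: opsymb_simps distrib_right)
qed simp

lift_definition dsymb :: "complex \<Rightarrow> diffop \<Rightarrow> complex poly" is opsymb .

lemma is_gamma_dsymb: "is_gamma k1 k2 (dsymb (of_real (rho k1 k2)))"
proof -
  have [simp]: "rcoeffs (op_poly P)" for P using op_poly[of P] by simp
  have "dsymb r (dconst c * P) = smult c (dsymb r P)" for r c P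
    by (simp add: dsymb.rep_eq times_diffop.rep_eq dconst.rep_eq opsymb_opmult)
  moreover have "dsymb r 1 = 1" for r
    by (simp add: dsymb.rep_eq one_diffop.rep_eq one_pCons)
  ultimately show ?thesis
    unfolding is_gamma_def
    by (simp add: dsymb.rep_eq plus_diffop.rep_eq times_diffop.rep_eq du1.rep_eq du2.rep_eq
        dxi.rep_eq opsymb_add opsymb_opmult one_pCons)
qed

lemma opmult_pCons_0: "opmult p (pCons 0 q) = pCons 0 (opmult p q)"
  by (induction p arbitrary: q) (auto simp: opmult_pCons dshift_pCons)

lemma opmult_xi: "opmult p [:0, 1:] = pCons 0 p"
  using opmult_pCons_0[of p 1] by (simp flip: one_pCons)

lemma is_gamma_unique:
  assumes g: "is_gamma k1 k2 g" and h: "is_gamma k1 k2 h"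
  shows "g = h"
proof
  have c: "g (dconst c) = h (dconst c)" for c
    using g h unfolding is_gamma_def by (metis mult.right_neutral)
  have R: "g (Abs_diffop [:f:]) = h (Abs_diffop [:f:])" if "f \<in> RR" for f
    using that
  proof induction
    case (const c)
    then show ?case using c by (simp add: dconst_def)
  next
    case u1
    then show ?case using g h by (simp add: is_gamma_def flip: du1_def)
  next
    case u2
    then show ?case using g h by (simp add: is_gamma_def flip: du2_def)
  next
    case (add x y)
    then have "Abs_diffop [:x + y:] = Abs_diffop [:x:] + Abs_diffop [:y:]"
      by (simp add: plus_diffop.abs_eq eq_onp_same_args)
    then show ?case using g h add by (simp add: is_gamma_def)
  next
    case (mult x y)
    then have "Abs_diffop [:x * y:] = Abs_diffop [:x:] * Abs_diffop [:y:]"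
      by (simp add: times_diffop.abs_eq eq_onp_same_args opmult_pCons)
    then show ?case using g h mult by (simp add: is_gamma_def)
  qed
  have P: "g (Abs_diffop p) = h (Abs_diffop p)" if "rcoeffs p" for p
    using that
  proof (induction p)
    case 0
    then show ?case using R[of 0] by simp
  next
    case (pCons a p)
    then have "Abs_diffop (pCons a p) = Abs_diffop [:a:] + Abs_diffop p * dxi"
      by (simp add: plus_diffop.abs_eq times_diffop.abs_eq dxi_def eq_onp_same_args opmult_xi)
    then show ?case using g h pCons R[of a] by (simp add: is_gamma_def)
  qed
  show "g D = h D" for D
    by (cases D) (simp add: P)
qed

lemma ex1_gamma: "\<exists>!g. is_gamma k1 k2 g"
  using is_gamma_dsymb is_gamma_unique by blast

lemma is_gamma_gamma: "is_gamma k1 k2 (gamma k1 k2)"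
  unfolding gamma_def by (rule theI'[OF ex1_gamma])

definition gamma_ns :: "real \<Rightarrow> real \<Rightarrow> diffop^2^2 \<Rightarrow> complex poly^2^2" where
  "gamma_ns k1 k2 M = (\<chi> i j. gamma k1 k2 (M $ i $ j))"


section \<open>Non-symmetric Jacobi polynomials\<close>

type_synonym laurent = "int \<Rightarrow>\<^sub>0 complex"  \<comment> \<open>Laurent polynomials as the group algebra of the integers\<close>

definition leval :: "laurent \<Rightarrow> complex \<Rightarrow> complex" where
  "leval f z = (\<Sum>n\<in>Poly_Mapping.keys f. Poly_Mapping.lookup f n * z powi n)"

definition lrat :: "laurent \<Rightarrow> ratfun \<Rightarrow> ratfun" where  \<comment> \<open>evaluation at a rational function\<close>
  "lrat f x = (\<Sum>n\<in>Poly_Mapping.keys f. rconst (Poly_Mapping.lookup f n) * x powi n)"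

text \<open>
  On the unit circle both bases below are nonnegative reals. For exponent 0 the value
  \<open>0 powr 0 = 0\<close> occurs only at \<open>z = \<plusminus>1\<close>, which does not affect the integral.
\<close>

definition jweight :: "real \<Rightarrow> real \<Rightarrow> complex \<Rightarrow> complex" where
  "jweight k1 k2 z = (1 - (z + inverse z) / 2) powr of_real k1
                   * (1 - (z ^ 2 + inverse z ^ 2) / 2) powr of_real k2"

definition jinner :: "real \<Rightarrow> real \<Rightarrow> laurent \<Rightarrow> laurent \<Rightarrow> complex" where
  "jinner k1 k2 f g = contour_integral (circlepath 0 1)
     (\<lambda>z. cnj (leval f z) * leval g z * jweight k1 k2 z / (\<i> * z))"

definition expo :: "nat \<Rightarrow> int" where  \<comment> \<open>the ordering \<open>0, 1, -1, 2, -2, \<dots>\<close>\<close>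
  "expo j = (if odd j then int ((j + 1) div 2) else - int (j div 2))"

definition expo_index :: "int \<Rightarrow> nat" where
  "expo_index n = (if n > 0 then nat (2 * n - 1) else nat (- 2 * n))"

lemma expo_expo_index [simp]: "expo (expo_index n) = n" and expo_index_expo [simp]: "expo_index (expo j) = j"
  by (auto simp: expo_def expo_index_def even_nat_iff elim!: oddE evenE)

fun gram_schmidt :: "real \<Rightarrow> real \<Rightarrow> nat \<Rightarrow> laurent" where
  "gram_schmidt k1 k2 j = Poly_Mapping.single (expo j) 1
     - (\<Sum>i<j. Poly_Mapping.single 0
          (jinner k1 k2 (gram_schmidt k1 k2 i) (Poly_Mapping.single (expo j) 1)
           / jinner k1 k2 (gram_schmidt k1 k2 i) (gram_schmidt k1 k2 i))
        * gram_schmidt k1 k2 i)"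

declare gram_schmidt.simps [simp del]

definition jacobi_E :: "real \<Rightarrow> real \<Rightarrow> int \<Rightarrow> laurent" where
  "jacobi_E k1 k2 n = gram_schmidt k1 k2 (expo_index n)"

definition jacobi_P :: "real \<Rightarrow> real \<Rightarrow> int \<Rightarrow> ratfun^2" where
  "jacobi_P k1 k2 n =
     vector [lrat (jacobi_E k1 k2 n) rZ, lrat (jacobi_E k1 k2 n) (inverse rZ)]"

definition spectral :: "real \<Rightarrow> real \<Rightarrow> int \<Rightarrow> real" where
  "spectral k1 k2 n = (if n > 0 then of_int n + rho k1 k2 else of_int n - rho k1 k2)"

end

theory Submission
  imports Defs
begin

text \<open>
  An invariant matrix operator has the form \<open>\<beta>(\<Gamma>\<^sub>*(X))\<close> for exactly one differential-reflection operator
  \<open>X = A + B s\<close>, and it commutes with the matrix form of the Cherednik operator \<open>C\<close> exactly when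
  \<open>X C = C X\<close>. The statement is therefore about the centralizer of \<open>C\<close> and about its eigenfunctions.

  The centralizer consists of the polynomials in \<open>C\<close> (\<open>commuting_cherednik_imp_poly_op\<close>). With
  \<open>C = \<partial> + h + g s\<close> the reflection part of \<open>X C = C X\<close> expresses \<open>2 B \<partial>\<close> up to lower order by terms of
  order at most that of \<open>A\<close>, because \<open>s\<close> anticommutes with \<open>\<partial>\<close>; hence \<open>B\<close> has smaller order than \<open>A\<close>. The
  scalar part then says that the leading coefficient of \<open>A\<close> is annihilated by \<open>\<partial>\<close>, so it is a constant
  \<open>c\<close>, and \<open>X - c C\<^sup>m\<close> commutes with \<open>C\<close> and has smaller order. The polynomial is read off by the
  constant term map: \<open>\<gamma>\<close> sends the matrix form of \<open>C\<close> to an upper triangular matrix with corner \<open>\<xi>\<close>, so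
  the corner of \<open>p(C)\<close> is \<open>p\<close> itself (\<open>gamma_poly_op_cherednik\<close>).

  The eigenvalue equation for \<open>p(C)\<close> follows from the one for \<open>C\<close>, which is the classical argument. On
  monomials \<open>C\<close> is triangular for the ordering \<open>1, z, z\<^sup>-\<^sup>1, z\<^sup>2, \<dots>\<close>, with the spectral values on the diagonal
  (\<open>below_index_cherednik_monomial\<close>), and it is symmetric for the inner product
  (\<open>jinner_cherednik_symmetric\<close>). If \<open>E\<close> is a Gram-Schmidt vector and \<open>\<lambda>\<close> its diagonal entry, the residue
  \<open>r = C E - \<lambda> E\<close> lies in the span of the earlier monomials, which \<open>C\<close> preserves and to which \<open>E\<close> is
  orthogonal; so \<open>\<langle>r, r\<rangle> = \<langle>C r, E\<rangle> - \<lambda> \<langle>r, E\<rangle> = 0\<close>, and \<open>r = 0\<close> by definiteness.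
\<close>

section \<open>Constants of the Euler derivation\<close>

lemma lead_coeff_pderiv_char_0:
  fixes p :: "'a::{idom, semiring_char_0} poly"
  shows "lead_coeff (pderiv p) = of_nat (degree p) * lead_coeff p"
  by (cases "degree p") (auto simp: degree_pderiv coeff_pderiv coeff_eq_0)

text \<open>
  For \<open>f = a/b\<close> the hypothesis reads \<open>a' b = a b'\<close>, and it persists when a multiple of \<open>b\<close> is subtracted
  from \<open>a\<close>. Choosing the multiple that removes the coefficient of \<open>a\<close> at the degree of \<open>b\<close> leaves a
  numerator \<open>r\<close>; if it were nonzero, comparing leading coefficients in \<open>r' b = r b'\<close> would force it to have
  the degree of \<open>b\<close>.
\<close>

lemma euler_eq_0_imp_rconst:
  assumes "euler f = 0"
  obtains c where "f = rconst c"
proof (cases f)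
  case (Fract a b)
  have "to_fract ([:0, 1:] * (pderiv a * b - a * pderiv b)) = 0"
    using assms Fract by (simp add: euler_Fract Zero_fract_def to_fract_def eq_fract)
  then have "pderiv a * b - a * pderiv b = 0" by (simp only: to_fract_eq_0_iff) simp
  then have ab: "pderiv a * b = a * pderiv b" by simp
  \<comment> \<open>the only candidate for the constant: it makes the coefficient of \<open>r\<close> at the degree of \<open>b\<close> vanish\<close>
  define c where "c = coeff a (degree b) / lead_coeff b"
  define r where "r = a - smult c b"
  have rb: "pderiv r * b = r * pderiv b"
    using ab by (simp add: r_def pderiv_diff pderiv_smult algebra_simps)
  have "r = 0"
  proof (rule ccontr)
    assume r: "r \<noteq> 0"
    have "of_nat (degree r) * lead_coeff r * lead_coeff b
        = of_nat (degree b) * lead_coeff r * lead_coeff b"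
      using arg_cong[OF rb, of lead_coeff]
      by (simp only: lead_coeff_mult lead_coeff_pderiv_char_0 mult_ac)
    then have "degree r = degree b" using r Fract by simp
    moreover have "coeff r (degree b) = 0" using Fract by (simp add: r_def c_def)
    ultimately show False using r by (metis leading_coeff_0_iff)
  qed
  then have "f = rconst c"
    using Fract by (simp add: r_def rconst_def to_fract_def eq_fract)
  then show ?thesis by (rule that)
qed

section \<open>Orders of scalar differential operators\<close>

text \<open>
  A strict bound on the order, rather than the order itself, makes the zero operator the one of order
  below 0, where the induction on the order starts.
\<close>

definition order_less :: "'a::zero poly \<Rightarrow> nat \<Rightarrow> bool" where
  "order_less p m \<longleftrightarrow> (\<forall>i\<ge>m. coeff p i = 0)"

lemma order_less_0 [simp]: "order_less 0 m" "order_less p 0 \<longleftrightarrow> p = 0"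
  by (auto simp: order_less_def poly_eq_iff)

lemma order_lessD: "order_less p m \<Longrightarrow> m \<le> i \<Longrightarrow> coeff p i = 0"
  by (simp add: order_less_def)

lemma order_less_mono: "order_less p m \<Longrightarrow> m \<le> n \<Longrightarrow> order_less p n"
  by (auto simp: order_less_def)

lemma order_less_pCons: "order_less (pCons a p) (Suc m) \<longleftrightarrow> order_less p m"
  by (auto simp: order_less_def coeff_pCons Suc_le_eq split: nat.splits)

lemma order_less_add: "order_less p m \<Longrightarrow> order_less q m \<Longrightarrow> order_less (p + q) m"
  by (simp add: order_less_def)

lemma order_less_map_euler: "order_less p m \<Longrightarrow> order_less (map_poly euler p) m"
  by (simp add: order_less_def coeff_map_poly)

lemma order_less_opflip: "order_less p m \<Longrightarrow> order_less (opflip p) m"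
  by (simp add: order_less_def coeff_opflip)

lemma order_less_smult: "order_less p m \<Longrightarrow> order_less (smult a p) m"
  by (simp add: order_less_def)

lemma opmult_const_pCons:
  "opmult (pCons a p) [:h:] = [:a * h:] + opmult p [:euler h:] + pCons 0 (opmult p [:h:])"
proof -
  have "dshift [:h:] = [:euler h:] + pCons 0 [:h:]" by (simp add: dshift_pCons)
  then show ?thesis by (simp only: opmult_pCons opmult_add_right opmult_pCons_0) simp
qed

lemma order_less_opmult_const:
  "order_less p m \<Longrightarrow> order_less (opmult p [:h:]) m"
proof (induction p arbitrary: m h)
  case (pCons a p)
  show ?case
  proof (cases m)
    case (Suc n)
    then have p: "order_less p n" using pCons.prems by (simp add: order_less_pCons)
    have "order_less (opmult p [:euler h:]) m"
      using order_less_mono[OF pCons.IH[OF p]] Suc by simp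
    with pCons.IH[OF p] Suc show ?thesis
      by (auto simp: opmult_const_pCons order_less_pCons intro!: order_less_add)
  qed (use pCons in simp)
qed simp

text \<open>
  Moving a function past \<open>f \<partial>\<^sup>i\<close> only produces terms in which some of the derivatives have been spent on
  the function.
\<close>

lemma order_less_commutator_const:
  "order_less p (Suc m) \<Longrightarrow> order_less (opmult p [:h:] - smult h p) m"
proof (induction p arbitrary: m)
  case (pCons a p)
  then have p: "order_less p m" by (simp add: order_less_pCons)
  have eq: "opmult (pCons a p) [:h:] - smult h (pCons a p)
      = opmult p [:euler h:] + pCons 0 (opmult p [:h:] - smult h p)"
    by (simp add: opmult_const_pCons)
  show ?case
  proof (cases m)
    case 0
    then show ?thesis using p eq by simp
  next
    case (Suc n)
    then show ?thesis unfolding eq using pCons.IH p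
      by (intro order_less_add order_less_opmult_const) (auto simp: order_less_pCons)
  qed
qed simp

text \<open>
  The hypothesis is the coefficient of \<open>s\<close> in \<open>X C = C X\<close> for \<open>X = A + B s\<close>, \<open>C = \<partial> + h + g s\<close>; here
  \<open>h'\<close> and \<open>-1\<close> are the coefficients of \<open>s(\<partial> + h)\<close>. The sign flip of \<open>\<partial>\<close> under \<open>s\<close> makes the two
  contributions \<open>B \<partial>\<close> add up instead of cancelling, and nothing else in the equation has an order as high
  as \<open>B \<partial>\<close> unless the order of \<open>A\<close> exceeds that of \<open>B\<close>.
\<close>

lemma reflection_part_order_of_commuting:
  fixes A B :: "ratfun poly"
  assumes A: "order_less A (Suc m)"
    and s_part: "opmult A [:g:] + opmult B [:h', -1:] = opmult [:h, 1:] B + smult g (opflip A)"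
  shows "order_less B m"
proof -
  have "opmult [:h, 1:] B = smult h B + map_poly euler B + pCons 0 B"
    by (simp add: opmult_pCons dshift_def one_pCons[symmetric])
  moreover have "opmult B [:h', -1:] = opmult B [:h':] - pCons 0 B"
  proof -
    have "[:h', -1:] = [:h':] + - [:0, 1:]" by simp
    then show ?thesis
      by (simp only: opmult_add_right opmult_minus opmult_xi) simp
  qed
  ultimately have "opmult A [:g:] + (opmult B [:h':] - pCons 0 B)
      = smult h B + map_poly euler B + pCons 0 B + smult g (opflip A)"
    using s_part by (simp only:)
  then have eq: "pCons 0 B + pCons 0 B
      = opmult A [:g:] + opmult B [:h':] + - smult h B + - map_poly euler B + - smult g (opflip A)"
    by algebra
  show ?thesis
  proof (rule ccontr)
    assume "\<not> order_less B m"
    then obtain i where i: "i \<ge> m" "coeff B i \<noteq> 0" by (auto simp: order_less_def)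
    define d where "d = degree B"
    have d: "m \<le> d" "coeff B d \<noteq> 0"
      using i le_degree[of B i] by (auto simp: d_def)
    have B: "order_less B (Suc d)" by (auto simp: order_less_def d_def intro: coeff_eq_0)
    have A': "order_less A (Suc d)" using A d by (auto intro: order_less_mono)
    have "coeff (pCons 0 B + pCons 0 B) (Suc d) = 0"
      unfolding eq coeff_add coeff_minus coeff_smult
      by (simp add: order_lessD[OF order_less_opmult_const[OF A']] order_lessD[OF B]
        order_lessD[OF order_less_opmult_const[OF B]] order_lessD[OF order_less_map_euler[OF B]]
        order_lessD[OF order_less_opflip[OF A']])
    then have "rconst (1 + 1) * coeff B d = 0"
      by (simp only: rconst_simps(2,3) distrib_right coeff_add coeff_pCons_Suc mult_1)
    then show False using d by (simp only: mult_eq_0_iff rconst_simps(7)) simp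
  qed
qed

text \<open>
  The hypothesis is the part without \<open>s\<close> of \<open>X C = C X\<close>. After the terms \<open>A \<partial>\<close> cancel, what
  remains besides the coefficientwise derivative of \<open>A\<close> is a commutator with \<open>h\<close> and two terms in \<open>B\<close>, all
  of order below \<open>m\<close>.
\<close>

lemma leading_coeff_constant_of_commuting:
  fixes A B :: "ratfun poly"
  assumes A: "order_less A (Suc m)" and B: "order_less B m"
    and part: "opmult A [:h, 1:] + opmult B [:g':] = opmult [:h, 1:] A + smult g (opflip B)"
  shows "euler (coeff A m) = 0"
proof -
  have "opmult [:h, 1:] A = smult h A + map_poly euler A + pCons 0 A"
    by (simp add: opmult_pCons dshift_def one_pCons[symmetric])
  moreover have "opmult A [:h, 1:] = opmult A [:h:] + pCons 0 A"
  proof -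
    have "[:h, 1:] = [:h:] + [:0, 1:]" by simp
    then show ?thesis
      by (simp only: opmult_add_right opmult_xi)
  qed
  ultimately have eq: "map_poly euler A
      = (opmult A [:h:] - smult h A) + opmult B [:g':] + - smult g (opflip B)"
    using part by (simp add: algebra_simps)
  have "coeff (map_poly euler A) m = 0"
    unfolding eq coeff_add coeff_minus coeff_smult
    by (simp add: order_lessD[OF order_less_commutator_const[OF A], unfolded coeff_diff coeff_smult]
       order_lessD[OF order_less_opmult_const[OF B]] order_lessD[OF order_less_opflip[OF B]])
  then show ?thesis by (simp add: coeff_map_poly)
qed

section \<open>The centralizer of the Cherednik operator\<close>

definition cherednik_coeff :: "real \<Rightarrow> real \<Rightarrow> ratfun" where
  "cherednik_coeff k1 k2 = rconst (of_real k1) * u1 + rconst (of_real (2 * k2)) * u2"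

lemma op_poly_cherednik:
  "op_poly (dpart (cherednik k1 k2)) = [:cherednik_coeff k1 k2 - rconst (of_real (rho k1 k2)), 1:]"
  "op_poly (rpart (cherednik k1 k2)) = [:- cherednik_coeff k1 k2:]"
  by (simp_all add: cherednik_def rs_def one_dreflop_def plus_dreflop_def minus_dreflop_def
      uminus_dreflop_def times_dreflop_def plus_diffop.rep_eq minus_diffop.rep_eq uminus_diffop.rep_eq
      times_diffop.rep_eq dconst.rep_eq du1.rep_eq du2.rep_eq dxi.rep_eq zero_diffop.rep_eq
      one_diffop.rep_eq dflip.rep_eq opmult_pCons opflip_pCons one_pCons cherednik_coeff_def algebra_simps)

lemma dconst_central: "dconst c * P = P * dconst c"
proof -
  have "opmult p [:rconst c:] = smult (rconst c) p" for p
    by (induction p) (simp_all add: opmult_const_pCons)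
  then show ?thesis by transfer (simp add: opmult_pCons)
qed

lemma dflip_dconst [simp]: "dflip (dconst c) = dconst c"
  by transfer (simp add: opflip_pCons)

lemma dconst_simps [simp]: "dconst (a + b) = dconst a + dconst b" "dconst 0 = 0"
  by (transfer; simp)+

lemma of_diffop_dconst_central: "of_diffop (dconst c) * X = X * of_diffop (dconst c)"
  by (simp add: times_dreflop_def dconst_central)

text \<open>
  A summation range that does not depend on the degree makes \<open>poly_op\<close> additive in the polynomial.
\<close>

lemma poly_op_bound:
  assumes "degree p \<le> n"
  shows "poly_op p X = (\<Sum>i\<le>n. of_diffop (dconst (coeff p i)) * X ^ i)"
  unfolding poly_op_def
  by (rule sum.mono_neutral_left) (use assms in \<open>auto simp: coeff_eq_0 simp flip: zero_dreflop_def\<close>)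

lemma poly_op_add: "poly_op (p + q) X = poly_op p X + poly_op q X"
proof -
  define n where "n = max (degree p) (degree q)"
  have "of_diffop (A + B) = of_diffop A + of_diffop B" for A B
    by (simp add: plus_dreflop_def)
  then show ?thesis
    by (simp add: poly_op_bound[of _ n] degree_add_le_max n_def distrib_right sum.distrib)
qed

lemma poly_op_monom: "poly_op (monom c n) X = of_diffop (dconst c) * X ^ n"
proof -
  have "poly_op (monom c n) X = (\<Sum>i\<le>n. of_diffop (dconst (coeff (monom c n) i)) * X ^ i)"
    by (rule poly_op_bound) (rule degree_monom_le)
  also have "\<dots> = (\<Sum>i\<in>{n}. of_diffop (dconst (coeff (monom c n) i)) * X ^ i)"
    by (rule sum.mono_neutral_right) (auto simp flip: zero_dreflop_def)
  finally show ?thesis by simp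
qed

lemma poly_op_0 [simp]: "poly_op 0 X = 0"
  by (simp add: poly_op_def flip: zero_dreflop_def)

text \<open>
  The powers of \<open>C\<close> are monic of the expected order; they are the operators subtracted when the order of an
  element of the centralizer is lowered.
\<close>

lemma power_cherednik:
  fixes k1 k2 :: real
  defines "C \<equiv> cherednik k1 k2"
  shows "order_less (op_poly (dpart (C ^ n))) (Suc n) \<and> coeff (op_poly (dpart (C ^ n))) n = 1
    \<and> order_less (op_poly (rpart (C ^ n))) (Suc n)"
proof (induction n)
  case 0
  show ?case
    by (simp add: one_dreflop_def one_diffop.rep_eq zero_diffop.rep_eq order_less_def)
next
  case (Suc n)
  define A B where "A = op_poly (dpart (C ^ n))" and "B = op_poly (rpart (C ^ n))"
  define h g where "h = cherednik_coeff k1 k2 - rconst (of_real (rho k1 k2))" and "g = - cherednik_coeff k1 k2"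
  have C: "op_poly (dpart C) = [:h, 1:]" "op_poly (rpart C) = [:g:]"
    by (simp_all add: C_def op_poly_cherednik h_def g_def)
  have mult: "opmult [:h, 1:] p = smult h p + map_poly euler p + pCons 0 p" for p
    by (simp add: opmult_pCons dshift_def one_pCons[symmetric])
  have mult_g: "opmult [:g:] p = smult g p" for p
    by (simp add: opmult_pCons)
  have A': "op_poly (dpart (C ^ Suc n)) = smult h A + map_poly euler A + pCons 0 A + smult g (opflip B)"
    and B': "op_poly (rpart (C ^ Suc n)) = smult h B + map_poly euler B + pCons 0 B + smult g (opflip A)"
    by (simp_all add: times_dreflop_def plus_diffop.rep_eq times_diffop.rep_eq dflip.rep_eq C
        A_def B_def mult mult_g)
  have A: "order_less A (Suc n)" "coeff A n = 1" and B: "order_less B (Suc n)"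
    using Suc by (auto simp: A_def B_def)
  have "order_less (smult h p + map_poly euler p + pCons 0 p + smult g (opflip q)) (Suc (Suc n))"
    if "order_less p (Suc n)" "order_less q (Suc n)" for p q
    using order_less_mono[OF that(1), of "Suc (Suc n)"] order_less_mono[OF that(2), of "Suc (Suc n)"] that
    by (intro order_less_add order_less_smult order_less_map_euler order_less_opflip)
      (auto simp: order_less_pCons)
  moreover have "coeff (op_poly (dpart (C ^ Suc n))) (Suc n) = 1"
    unfolding A' using A B by (simp add: order_lessD coeff_map_poly order_lessD[OF order_less_opflip])
  ultimately show ?case using A B by (simp only: A' B')
qed

text \<open>
  Induction on the order of the part without reflection: its leading coefficient is a constant \<open>c\<close>, and
  \<open>X - c C\<^sup>m\<close> is again in the centralizer. In the base case that part vanishes, and then the reflection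
  part does too.
\<close>

proposition commuting_cherednik_imp_poly_op:
  fixes X :: dreflop
  assumes "X * cherednik k1 k2 = cherednik k1 k2 * X"
  obtains q where "X = poly_op q (cherednik k1 k2)"
proof -
  define C where "C = cherednik k1 k2"
  define h g where "h = cherednik_coeff k1 k2 - rconst (of_real (rho k1 k2))" and "g = - cherednik_coeff k1 k2"
  have C: "op_poly (dpart C) = [:h, 1:]" "op_poly (rpart C) = [:g:]"
    by (simp_all add: C_def op_poly_cherednik h_def g_def)
  have comm: "opmult A [:h, 1:] + opmult B [:rflip g:] = opmult [:h, 1:] A + smult g (opflip B)"
      "opmult A [:g:] + opmult B [:rflip h, -1:] = opmult [:h, 1:] B + smult g (opflip A)"
    if "X * C = C * X" "A = op_poly (dpart X)" "B = op_poly (rpart X)" for X A B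
    using arg_cong[OF that(1), of "\<lambda>Y. op_poly (dpart Y)"]
      arg_cong[OF that(1), of "\<lambda>Y. op_poly (rpart Y)"] that(2,3)
    by (simp_all add: times_dreflop_def plus_diffop.rep_eq times_diffop.rep_eq dflip.rep_eq C
        opflip_pCons opmult_pCons one_pCons)
  have "\<exists>q. X = poly_op q C" if "X * C = C * X" "order_less (op_poly (dpart X)) m" for X m
    using that
  proof (induction m arbitrary: X)
    case 0
    then have "order_less (op_poly (dpart X)) (Suc i)" for i by simp
    then have "order_less (op_poly (rpart X)) i" for i
      using reflection_part_order_of_commuting[OF _ comm(2)[OF 0(1) refl refl]] by blast
    from this[of 0] 0(2) have "dpart X = 0" "rpart X = 0"
      by (metis op_poly_inject order_less_0(2) zero_diffop.rep_eq)+
    then have "X = poly_op 0 C" by (cases X) (simp add: zero_dreflop_def)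
    then show ?case ..
  next
    case (Suc m)
    define A B where "A = op_poly (dpart X)" and "B = op_poly (rpart X)"
    have A: "order_less A (Suc m)" using Suc by (simp add: A_def)
    have B: "order_less B m"
      by (rule reflection_part_order_of_commuting[OF A comm(2)[OF Suc(2) A_def B_def]])
    have "euler (coeff A m) = 0"
      by (rule leading_coeff_constant_of_commuting[OF A B comm(1)[OF Suc(2) A_def B_def]])
    then obtain c where c: "coeff A m = rconst c" by (rule euler_eq_0_imp_rconst)
    define Y where "Y = X - of_diffop (dconst c) * C ^ m"
    have "Y * C = C * Y"
    proof -
      have "of_diffop (dconst c) * C ^ m * C = C * (of_diffop (dconst c) * C ^ m)"
        by (metis mult.assoc of_diffop_dconst_central power_commutes)
      then show ?thesis using Suc(2) by (simp only: Y_def left_diff_distrib right_diff_distrib)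
    qed
    moreover have "order_less (op_poly (dpart Y)) m"
    proof -
      have Y: "op_poly (dpart Y) = A - smult (rconst c) (op_poly (dpart (C ^ m)))"
        by (simp add: Y_def A_def minus_dreflop_def times_dreflop_def minus_diffop.rep_eq
            times_diffop.rep_eq dconst.rep_eq opmult_pCons)
      have "coeff (op_poly (dpart Y)) i = 0" if "i \<ge> m" for i
        using that A power_cherednik[of k1 k2 m] c unfolding Y C_def
        by (cases "i = m") (auto simp: order_lessD)
      then show ?thesis by (simp add: order_less_def)
    qed
    ultimately obtain q where "Y = poly_op q C" using Suc.IH by blast
    then have "X = poly_op (q + monom c m) C" by (simp add: Y_def poly_op_add poly_op_monom algebra_simps)
    then show ?case ..
  qed
  moreover have "order_less (op_poly (dpart X)) (Suc (degree (op_poly (dpart X))))"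
    by (auto simp: order_less_def intro: coeff_eq_0)
  ultimately show ?thesis using assms that C_def by blast
qed

section \<open>The constant term of a polynomial in the Cherednik operator\<close>

lemma dflip_generators:
  "dflip du1 = 1 - du1" "dflip du2 = 1 - du2" "dflip dxi = - dxi"
  by (transfer; simp add: opflip_pCons rflip_u one_pCons)+

lemma dflip_diff [simp]: "dflip (- P) = - dflip P" "dflip (P - Q) = dflip P - dflip Q"
proof -
  show m: "dflip (- P) = - dflip P" for P
    using dflip_simps(3)[of P "- P"] by (simp add: eq_neg_iff_add_eq_0 add.commute)
  show "dflip (P - Q) = dflip P - dflip Q" using dflip_simps(3)[of P "- Q"] m by simp
qed

lemma gamma_simps [simp]:
  "gamma k1 k2 0 = 0" "gamma k1 k2 1 = 1"
  "gamma k1 k2 (P + Q) = gamma k1 k2 P + gamma k1 k2 Q"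
  "gamma k1 k2 (P * Q) = gamma k1 k2 P * gamma k1 k2 Q"
  "gamma k1 k2 (- P) = - gamma k1 k2 P"
  "gamma k1 k2 (P - Q) = gamma k1 k2 P - gamma k1 k2 Q"
  "gamma k1 k2 (dconst c) = [:c:]"
  "gamma k1 k2 du1 = 1" "gamma k1 k2 du2 = 1" "gamma k1 k2 dxi = [:- of_real (rho k1 k2), 1:]"
proof -
  note g = is_gamma_gamma[of k1 k2, unfolded is_gamma_def]
  show add: "gamma k1 k2 (P + Q) = gamma k1 k2 P + gamma k1 k2 Q" for P Q using g by blast
  show 0: "gamma k1 k2 0 = 0" using add[of 0 0] by simp
  show m: "gamma k1 k2 (- P) = - gamma k1 k2 P" for P
    using add[of P "- P"] 0 by (simp add: eq_neg_iff_add_eq_0 add.commute)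
  show "gamma k1 k2 (P - Q) = gamma k1 k2 P - gamma k1 k2 Q" using add[of P "- Q"] m by simp
  show "gamma k1 k2 (dconst c) = [:c:]" using g by (metis mult.right_neutral smult_one)
qed (use is_gamma_gamma[of k1 k2, unfolded is_gamma_def] in blast)+

text \<open>
  In matrix form \<open>C\<close> has lower left entry \<open>s(g)\<close> with \<open>g = - k\<^sub>1 (1 - e\<^sup>-\<^sup>\<epsilon>)\<^sup>-\<^sup>1 - 2 k\<^sub>2 (1 - e\<^sup>-\<^sup>2\<^sup>\<epsilon>)\<^sup>-\<^sup>1\<close>. The
  constant term of this entry is 0, since \<open>s\<close> turns each generator \<open>u\<close> of the coefficient algebra into \<open>1 - u\<close>.
  On upper triangular matrices the upper left entry is multiplicative, and for \<open>C\<close> it is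
  \<open>(\<xi> - \<rho>) + k\<^sub>1 + 2 k\<^sub>2 - \<rho> = \<xi>\<close>.
\<close>

lemma gamma_poly_op_cherednik:
  "gamma k1 k2 (dpart (poly_op q (cherednik k1 k2))) = q"
proof -
  define C where "C = cherednik k1 k2"
  have C: "gamma k1 k2 (dpart C) = [:0, 1:]" "gamma k1 k2 (dflip (rpart C)) = 0"
    by (simp_all add: C_def cherednik_def rs_def one_dreflop_def plus_dreflop_def minus_dreflop_def
      uminus_dreflop_def times_dreflop_def dflip_generators rho_def one_pCons)
  have pow: "gamma k1 k2 (dflip (rpart (C ^ n))) = 0 \<and> gamma k1 k2 (dpart (C ^ n)) = monom 1 n" for n
  proof (induction n)
    case 0
    then show ?case by (simp add: one_dreflop_def monom_0 one_pCons)
  next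
    case (Suc n)
    then show ?case using C by (simp add: times_dreflop_def monom_Suc)
  qed
  have dsum: "dpart (sum f S) = (\<Sum>x\<in>S. dpart (f x))" for f and S :: "nat set"
    by (induction S rule: infinite_finite_induct) (simp_all add: zero_dreflop_def plus_dreflop_def)
  have gsum: "gamma k1 k2 (sum f S) = (\<Sum>x\<in>S. gamma k1 k2 (f x))" for f and S :: "nat set"
    by (induction S rule: infinite_finite_induct) simp_all
  have "gamma k1 k2 (dpart (poly_op q C)) = (\<Sum>i\<le>degree q. monom (coeff q i) i)"
    using pow by (simp add: poly_op_def dsum gsum times_dreflop_def smult_monom)
  then show ?thesis by (simp add: C_def poly_as_sum_of_monoms)
qed

text \<open>
  Invariance under \<open>s\<close> determines the second row from the first, and the first row of the commutation
  relation consists of the two components of \<open>X C = C X\<close>.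
\<close>

lemma D_ns_imp_beta_ns:
  assumes "D \<in> D_ns k1 k2"
  obtains X where "D = beta_ns (Gamma_star X)" "X * cherednik k1 k2 = cherednik k1 k2 * X"
proof -
  define X where "X = DRefl (D $ 1 $ 1) (D $ 1 $ 2)"
  have inv: "mat_flip D = D" and comm: "D ** D_tilde k1 k2 = D_tilde k1 k2 ** D"
    using assms by (auto simp: D_ns_def)
  have flip: "D $ 2 $ 2 = dflip (D $ 1 $ 1)" "D $ 2 $ 1 = dflip (D $ 1 $ 2)"
    using arg_cong[OF inv, of "\<lambda>M. M $ 2 $ 2"] arg_cong[OF inv, of "\<lambda>M. M $ 2 $ 1"]
    by (simp_all add: mat_flip_def pi_s_def matrix_matrix_mult_def sum_2)
  have D: "D = beta_ns (Gamma_star X)"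
    by (simp add: X_def beta_ns_Gamma_star vec_eq_iff forall_2 flip)
  obtain A B where AB: "cherednik k1 k2 = DRefl A B" by (cases "cherednik k1 k2")
  have "X * cherednik k1 k2 = cherednik k1 k2 * X"
    using arg_cong[OF comm, of "\<lambda>M. M $ 1 $ 1"] arg_cong[OF comm, of "\<lambda>M. M $ 1 $ 2"]
    by (simp add: D_tilde_def AB beta_ns_Gamma_star matrix_matrix_mult_def sum_2 times_dreflop_def
        X_def flip)
  with D show ?thesis by (rule that)
qed

section \<open>Action on rational functions\<close>

definition reflection_act :: "dreflop \<Rightarrow> ratfun \<Rightarrow> ratfun" where
  "reflection_act X f = dact (dpart X) f + dact (rpart X) (rflip f)"

lemma opact_add_right: "opact p (f + g) = opact p f + opact p g"
  by (induction p arbitrary: f g) (simp_all add: opact_pCons algebra_simps)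

lemma opact_rconst: "opact p (rconst c * f) = rconst c * opact p f"
  by (induction p arbitrary: f) (simp_all add: opact_pCons euler_mult algebra_simps)

lemma opact_minus_right: "opact p (- f) = - opact p f"
  using opact_rconst[of p "-1" f] by simp

lemma opact_minus_left: "opact (- p) f = - opact p f"
  using opact_add[of p "- p" f] by (simp add: eq_neg_iff_add_eq_0 add.commute)

lemma rflip_opact: "rflip (opact p f) = opact (opflip p) (rflip f)"
  by (induction p arbitrary: f)
    (simp_all add: opact_pCons opflip_pCons euler_rflip opact_minus_right opact_minus_left)

lemma dact_simps:
  "dact P (f + g) = dact P f + dact P g" "dact (P + Q) f = dact P f + dact Q f"
  "dact P (rconst c * f) = rconst c * dact P f"
  "rflip (dact P f) = dact (dflip P) (rflip f)" "dact 0 f = 0" "dact 1 f = f"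
proof -
  show "dact P (f + g) = dact P f + dact P g" by transfer (rule opact_add_right)
  show "dact (P + Q) f = dact P f + dact Q f" by transfer (rule opact_add)
  show "dact P (rconst c * f) = rconst c * dact P f" by transfer (rule opact_rconst)
  show "rflip (dact P f) = dact (dflip P) (rflip f)" by transfer (rule rflip_opact)
  show "dact 0 f = 0" by transfer (rule opact_0)
  show "dact 1 f = f" by transfer (simp add: opact_def)
qed

lemma reflection_act_simps:
  "reflection_act (X + Y) f = reflection_act X f + reflection_act Y f" "reflection_act (X * Y) f = reflection_act X (reflection_act Y f)"
  "reflection_act X (rconst c * f) = rconst c * reflection_act X f" "reflection_act 1 f = f" "reflection_act 0 f = 0"
  "reflection_act (of_diffop (dconst c)) f = rconst c * f"
proof -
  show "reflection_act X (rconst c * f) = rconst c * reflection_act X f"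
    by (simp add: reflection_act_def dact_simps distrib_left)
  show "reflection_act (X * Y) f = reflection_act X (reflection_act Y f)"
    by (simp add: reflection_act_def times_dreflop_def dact_simps dact_mult)
  show "reflection_act (X + Y) f = reflection_act X f + reflection_act Y f"
    by (simp add: reflection_act_def plus_dreflop_def dact_simps)
qed (simp_all add: reflection_act_def one_dreflop_def zero_dreflop_def dact_simps dact_generators)

lemma mat_act_beta_ns:
  "mat_act (beta_ns (Gamma_star X)) (vector [f, rflip f]) = vector [reflection_act X f, rflip (reflection_act X f)]"
  by (cases X) (simp add: mat_act_def vec_eq_iff forall_2 sum_2 beta_ns_Gamma_star reflection_act_def dact_simps)

lemma reflection_act_poly_op_eigen:
  assumes "reflection_act X f = rconst c * f"
  shows "reflection_act (poly_op p X) f = rconst (poly p c) * f"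
proof -
  have pow: "reflection_act (X ^ n) f = rconst (c ^ n) * f" for n
    by (induction n) (simp_all add: reflection_act_simps assms)
  have "reflection_act (sum F S) f = (\<Sum>x\<in>S. reflection_act (F x) f)" for F and S :: "nat set"
    by (induction S rule: infinite_finite_induct) (simp_all add: reflection_act_simps)
  moreover have "rconst (sum F S) = (\<Sum>x\<in>S. rconst (F x))" for F and S :: "nat set"
    by (induction S rule: infinite_finite_induct) simp_all
  ultimately show ?thesis
    by (simp add: poly_op_def poly_altdef reflection_act_simps pow sum_distrib_right mult.assoc)
      (simp only: mult.left_commute)
qed

lemma reflection_act_cherednik:
  "reflection_act (cherednik k1 k2) f
    = euler f + cherednik_coeff k1 k2 * (f - rflip f) - rconst (of_real (rho k1 k2)) * f"
  by (simp add: reflection_act_def dact.rep_eq op_poly_cherednik opact_pCons opact_def algebra_simps)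

section \<open>The Cherednik operator on Laurent polynomials\<close>

definition linear_extension :: "(int \<Rightarrow> laurent) \<Rightarrow> laurent \<Rightarrow> laurent" where
  "linear_extension g f = (\<Sum>n\<in>Poly_Mapping.keys f. Poly_Mapping.single 0 (Poly_Mapping.lookup f n) * g n)"

lemma lookup_scale: "Poly_Mapping.lookup (Poly_Mapping.single 0 c * f) n = c * Poly_Mapping.lookup f n"
  for f :: laurent
  by (simp add: mult_map_scale_conv_mult[symmetric] Poly_Mapping.map.rep_eq when_def)

lemma keys_scale: "Poly_Mapping.keys (Poly_Mapping.single 0 c * f) \<subseteq> Poly_Mapping.keys f" for f :: laurent
  by (auto simp: in_keys_iff lookup_scale)

lemma lookup_linear_extension:
  "Poly_Mapping.lookup (linear_extension g f) j
    = (\<Sum>n\<in>Poly_Mapping.keys f. Poly_Mapping.lookup f n * Poly_Mapping.lookup (g n) j)"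
  by (simp add: linear_extension_def lookup_sum lookup_scale)

lemma linear_extension_add: "linear_extension g (f + f') = linear_extension g f + linear_extension g f'"
proof -
  define A where "A = Poly_Mapping.keys f \<union> Poly_Mapping.keys f'"
  have sup: "linear_extension g h = (\<Sum>n\<in>A. Poly_Mapping.single 0 (Poly_Mapping.lookup h n) * g n)"
    if "Poly_Mapping.keys h \<subseteq> A" for h
    unfolding linear_extension_def
    by (rule sum.mono_neutral_left) (use that in \<open>auto simp: A_def in_keys_iff\<close>)
  have "Poly_Mapping.keys (f + f') \<subseteq> A" "Poly_Mapping.keys f \<subseteq> A" "Poly_Mapping.keys f' \<subseteq> A"
    using keys_add[of f f'] by (auto simp: A_def)
  then show ?thesis by (simp add: sup lookup_add single_add distrib_right sum.distrib)
qed

text \<open>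
  Evaluation of Laurent polynomials in a field, through a ring homomorphism on the coefficients. It covers
  both the values on the unit circle, where the inner product lives, and the rational functions in \<open>z\<close>, on
  which the differential operators act.
\<close>

locale laurent_evaluation =
  fixes h :: "complex \<Rightarrow> 'a::field"
  assumes h_add: "h (a + b) = h a + h b" and h_mult: "h (a * b) = h a * h b" and h_1: "h 1 = 1"
begin

definition lev :: "laurent \<Rightarrow> 'a \<Rightarrow> 'a" where
  "lev f x = (\<Sum>n\<in>Poly_Mapping.keys f. h (Poly_Mapping.lookup f n) * x powi n)"

lemma h_0: "h 0 = 0"
proof -
  have "h 0 + h 0 = h 0 + 0" using h_add[of 0 0] by simp
  then show ?thesis by (simp only: add_left_cancel)
qed

lemma h_diff: "h (a - b) = h a - h b"
  using h_add[of "a - b" b] by simp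

lemma lev_superset:
  assumes "finite A" "Poly_Mapping.keys f \<subseteq> A"
  shows "lev f x = (\<Sum>n\<in>A. h (Poly_Mapping.lookup f n) * x powi n)"
  unfolding lev_def by (rule sum.mono_neutral_left) (use assms in \<open>auto simp: in_keys_iff h_0\<close>)

lemma lev_add: "lev (f + g) x = lev f x + lev g x"
proof -
  define A where "A = Poly_Mapping.keys f \<union> Poly_Mapping.keys g"
  have "Poly_Mapping.keys (f + g) \<subseteq> A" "finite A"
    using keys_add[of f g] by (auto simp: A_def)
  then show ?thesis
    by (simp add: lev_superset[of A] A_def lookup_add h_add distrib_right sum.distrib)
qed

lemma lev_0 [simp]: "lev 0 x = 0"
  by (simp add: lev_def)

lemma lev_sum: "lev (sum F S) x = (\<Sum>i\<in>S. lev (F i) x)"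
  by (induction S rule: infinite_finite_induct) (simp_all add: lev_add)

lemma lev_diff: "lev (f - g) x = lev f x - lev g x"
  using lev_add[of "f - g" g] by (simp add: algebra_simps)

lemma lev_minus: "lev (- f) x = - lev f x"
  using lev_diff[of 0 f] by simp

lemma lev_scale: "lev (Poly_Mapping.single 0 c * f) x = h c * lev f x"
  by (subst lev_superset[OF finite_keys keys_scale])
    (simp_all add: lev_def lookup_scale h_mult sum_distrib_left mult.assoc)

lemma lev_single: "lev (Poly_Mapping.single n c) x = h c * x powi n"
  by (simp add: lev_def h_0)

lemma lev_linear_extension:
  "lev (linear_extension g f) x = (\<Sum>n\<in>Poly_Mapping.keys f. h (Poly_Mapping.lookup f n) * lev (g n) x)"
  by (simp add: linear_extension_def lev_sum lev_scale)

end

definition leuler :: "laurent \<Rightarrow> laurent" where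
  "leuler = linear_extension (\<lambda>n. Poly_Mapping.single n (of_int n))"

text \<open>
  The Laurent polynomial \<open>(z\<^sup>n - z\<^sup>-\<^sup>n) / (1 - z\<^sup>-\<^sup>s)\<close> for \<open>s = 1, 2\<close>, written as a geometric sum.
\<close>

definition geo_string :: "nat \<Rightarrow> int \<Rightarrow> laurent" where
  "geo_string s n = (if n \<ge> 0
     then \<Sum>i<nat (2 * n) div s. Poly_Mapping.single (n - int (s * i)) 1
     else - (\<Sum>i<nat (- 2 * n) div s. Poly_Mapping.single (- n - int (s * i)) 1))"

definition cherednik_monomial :: "real \<Rightarrow> real \<Rightarrow> int \<Rightarrow> laurent" where
  "cherednik_monomial k1 k2 n = Poly_Mapping.single n (of_int n - of_real (rho k1 k2))
     + Poly_Mapping.single 0 (of_real k1) * geo_string 1 n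
     + Poly_Mapping.single 0 (of_real (2 * k2)) * geo_string 2 n"

definition cherednik_laurent :: "real \<Rightarrow> real \<Rightarrow> laurent \<Rightarrow> laurent" where
  "cherednik_laurent k1 k2 = linear_extension (cherednik_monomial k1 k2)"

context laurent_evaluation
begin

lemma lev_geo_string:
  assumes "x \<noteq> 0" "x ^ s \<noteq> 1" "s \<in> {1, 2}"
  shows "lev (geo_string s n) x = inverse (1 - inverse x ^ s) * (x powi n - inverse x powi n)"
proof -
  have ne: "1 - inverse x ^ s \<noteq> 0"
    using assms by (auto simp: power_inverse)
  \<comment> \<open>the geometric sum telescopes after multiplication with the denominator\<close>
  have tel: "(1 - inverse x ^ s) * (\<Sum>i<m. x powi (N - int (s * i))) = x powi N - x powi (N - int (s * m))"
    for m N
  proof -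
    have "(1 - inverse x ^ s) * x powi (N - int (s * i))
        = x powi (N - int (s * i)) - x powi (N - int (s * Suc i))" for i
    proof -
      have "x powi (N - int (s * Suc i)) = x powi (N - int (s * i)) * x powi (- int s)"
        using assms by (simp add: algebra_simps flip: power_int_add)
      then show ?thesis by (simp add: power_int_minus power_inverse algebra_simps)
    qed
    then show ?thesis
      by (simp only: sum_distrib_left sum_lessThan_telescope'[of "\<lambda>i. x powi (N - int (s * i))"]) simp
  qed
  have pos: "(1 - inverse x ^ s) * (\<Sum>i<nat (2 * N) div s. x powi (N - int (s * i)))
      = x powi N - inverse x powi N" if "N \<ge> 0" for N
  proof -
    have "int (s * (nat (2 * N) div s)) = 2 * N" using assms that by auto
    then show ?thesis unfolding tel by (simp add: power_int_minus power_int_inverse)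
  qed
  have "(1 - inverse x ^ s) * lev (geo_string s n) x = x powi n - inverse x powi n"
  proof (cases "n \<ge> 0")
    case True
    then show ?thesis using pos[of n] by (simp add: geo_string_def lev_sum lev_single h_1)
  next
    case False
    then show ?thesis using pos[of "- n"]
      by (simp add: geo_string_def lev_sum lev_single h_1 lev_minus power_int_minus power_int_inverse)
  qed
  then show ?thesis using ne by (simp add: field_simps)
qed

text \<open>
  This is the formula for the Cherednik operator on functions, with the divided differences evaluated; it
  identifies \<open>cherednik_laurent\<close> with that operator wherever the denominators do not vanish.
\<close>

lemma lev_cherednik_laurent:
  assumes "x \<noteq> 0" "x ^ 2 \<noteq> 1"
  shows "lev (cherednik_laurent k1 k2 f) x = lev (leuler f) x
    + (h (of_real k1) * inverse (1 - inverse x) + h (of_real (2 * k2)) * inverse (1 - inverse x ^ 2))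
      * (lev f x - lev f (inverse x)) - h (of_real (rho k1 k2)) * lev f x"
proof -
  have "x ^ 1 \<noteq> 1" using assms(2) by auto
  note g = lev_geo_string[OF assms(1) this, simplified] lev_geo_string[OF assms, simplified]
  show ?thesis
    unfolding cherednik_laurent_def leuler_def lev_linear_extension
    unfolding lev_def[of f] sum_distrib_left sum_distrib_right sum.distrib[symmetric] sum_subtractf[symmetric]
    by (rule sum.cong[OF refl]) (simp add: cherednik_monomial_def lev_add lev_diff lev_scale lev_single h_diff g,
        simp add: algebra_simps)
qed

end

interpretation leval: laurent_evaluation "\<lambda>c. c :: complex"
  rewrites "laurent_evaluation.lev (\<lambda>c. c) = leval"
proof -
  show "laurent_evaluation (\<lambda>c. c :: complex)" by standard auto
  then show "laurent_evaluation.lev (\<lambda>c. c) = leval"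
    by (intro ext) (simp add: laurent_evaluation.lev_def leval_def)
qed

interpretation lrat: laurent_evaluation rconst
  rewrites "laurent_evaluation.lev rconst = lrat"
proof -
  show "laurent_evaluation rconst" by standard auto
  then show "laurent_evaluation.lev rconst = lrat"
    by (intro ext) (simp add: laurent_evaluation.lev_def lrat_def)
qed

lemma euler_power_int_rZ: "euler (rZ powi n) = rconst (of_int n) * rZ powi n"
proof -
  have p: "euler (rZ ^ m) = rconst (of_nat m) * rZ ^ m" for m
    by (induction m) (simp_all add: euler_mult euler_rZ algebra_simps)
  show ?thesis
  proof (cases n rule: int_cases2)
    case (nonneg m)
    then show ?thesis using p by simp
  next
    case (nonpos m)
    then have "euler (rZ powi n) = - (rconst (of_nat m) * rZ ^ m) / (rZ ^ m * rZ ^ m)"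
      by (simp add: power_int_minus euler_inverse p)
    also have "\<dots> = rconst (of_int n) * rZ powi n"
      using nonpos by (simp add: power_int_minus field_simps)
    finally show ?thesis .
  qed
qed

lemma euler_lrat: "euler (lrat f rZ) = lrat (leuler f) rZ"
  unfolding leuler_def lrat.lev_linear_extension
  by (simp add: lrat_def[of f] euler_sum euler_mult euler_power_int_rZ lrat.lev_single)

lemma rflip_lrat: "rflip (lrat f x) = lrat f (rflip x)"
proof -
  have p: "rflip (x ^ m) = rflip x ^ m" for m by (induction m) auto
  have "rflip (x powi n) = rflip x powi n" for n
    by (cases n rule: int_cases2) (simp_all add: power_int_minus p)
  moreover have "rflip (sum F S) = (\<Sum>i\<in>S. rflip (F i))" for F and S :: "int set"
    by (induction S rule: infinite_finite_induct) simp_all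
  ultimately show ?thesis by (simp add: lrat_def)
qed

section \<open>Triangularity\<close>

text \<open>
  Membership in the span of the first \<open>m\<close> monomials in the ordering \<open>1, z, z\<^sup>-\<^sup>1, z\<^sup>2, \<dots>\<close>.
\<close>

definition below_index :: "nat \<Rightarrow> laurent \<Rightarrow> bool" where
  "below_index m f \<longleftrightarrow> (\<forall>j. m \<le> expo_index j \<longrightarrow> Poly_Mapping.lookup f j = 0)"

lemma below_index_mono: "below_index m f \<Longrightarrow> m \<le> m' \<Longrightarrow> below_index m' f"
  by (auto simp: below_index_def)

lemma below_index_add: "below_index m f \<Longrightarrow> below_index m g \<Longrightarrow> below_index m (f + g)"
  by (simp add: below_index_def lookup_add)

lemma below_index_diff: "below_index m f \<Longrightarrow> below_index m g \<Longrightarrow> below_index m (f - g)"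
  by (simp add: below_index_def lookup_minus)

lemma below_index_scale: "below_index m f \<Longrightarrow> below_index m (Poly_Mapping.single 0 c * f)"
  by (simp add: below_index_def lookup_scale)

lemma below_index_sum: "(\<And>i. i \<in> S \<Longrightarrow> below_index m (F i)) \<Longrightarrow> below_index m (sum F S)"
  by (simp add: below_index_def lookup_sum)

lemma below_index_0: "below_index 0 f \<Longrightarrow> f = 0"
  by (auto simp: below_index_def intro: poly_mapping_eqI)

lemma below_index_single: "below_index (Suc (expo_index n)) (Poly_Mapping.single n c)"
  by (auto simp: below_index_def lookup_single when_def)

text \<open>
  The exponents in \<open>(z\<^sup>n - z\<^sup>-\<^sup>n) / (1 - z\<^sup>-\<^sup>s)\<close> lie in the half-open interval from \<open>-\<bar>n\<bar>\<close> (excluded) to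
  \<open>\<bar>n\<bar>\<close> (included). Apart from \<open>n\<close> itself, for positive \<open>n\<close>, they all precede \<open>n\<close> in the ordering.
\<close>

lemma below_index_geo_string:
  assumes s: "s \<in> {1, 2}"
  shows "below_index (expo_index n) (geo_string s n - Poly_Mapping.single n (if n > 0 then 1 else 0))"
  unfolding below_index_def
proof (intro allI impI)
  fix j assume j: "expo_index n \<le> expo_index j"
  define N where "N = \<bar>n\<bar>"
  have outer: "j = n \<or> j \<le> - N \<or> N < j"
    using j by (auto simp: N_def expo_index_def split: if_splits)
  have range: "0 \<le> int (s * i) \<and> int (s * i) < 2 * N" if "i < nat (2 * N) div s" for i
  proof -
    have "s * i < nat (2 * N)" using s that by auto
    then have "int (s * i) < 2 * N" by (simp only: zless_nat_eq_int_zless)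
    then show ?thesis by simp
  qed
  have zero: "(\<Sum>i<nat (2 * N) div s. (1 when N - int (s * i) = j)) = (0::complex)"
    if "\<not> (j = n \<and> n > 0)"
  proof (intro sum.neutral ballI)
    fix i assume "i \<in> {..<nat (2 * N) div s}"
    then have i: "0 \<le> int (s * i)" "int (s * i) < 2 * N" using range by auto
    have "N - int (s * i) \<noteq> j"
      using outer i that unfolding N_def by linarith
    then show "(1 when N - int (s * i) = j) = (0::complex)" by simp
  qed
  have one: "(\<Sum>i<nat (2 * n) div s. (1 when n - int (s * i) = n)) = (1::complex)" if "n > 0"
  proof -
    have "(\<Sum>i<nat (2 * n) div s. (1 when n - int (s * i) = n))
        = (\<Sum>i\<in>{0}. (1::complex) when n - int (s * i) = n)"
      by (rule sum.mono_neutral_right) (use s that in auto)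
    then show ?thesis by simp
  qed
  show "Poly_Mapping.lookup (geo_string s n - Poly_Mapping.single n (if n > 0 then 1 else 0)) j = 0"
  proof (cases "j = n \<and> n > 0")
    case False
    then show ?thesis using zero
      by (auto simp: geo_string_def lookup_minus lookup_sum lookup_single N_def when_def split: if_splits)
  next
    case True
    then show ?thesis using one
      by (simp add: geo_string_def lookup_minus lookup_sum lookup_single)
  qed
qed

text \<open>
  The diagonal entry is \<open>n - \<rho>\<close>, increased by \<open>k\<^sub>1 + 2 k\<^sub>2 = 2 \<rho>\<close> when \<open>n > 0\<close>.
\<close>

lemma below_index_cherednik_monomial:
  "below_index (expo_index n) (cherednik_monomial k1 k2 n - Poly_Mapping.single n (of_real (spectral k1 k2 n)))"
proof -
  define G where "G s = geo_string s n - Poly_Mapping.single n (if n > 0 then 1 else 0)" for s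
  have "cherednik_monomial k1 k2 n - Poly_Mapping.single n (of_real (spectral k1 k2 n))
      = Poly_Mapping.single 0 (of_real k1) * G 1 + Poly_Mapping.single 0 (of_real (2 * k2)) * G 2"
    by (rule poly_mapping_eqI)
      (auto simp: cherednik_monomial_def G_def lookup_add lookup_minus lookup_scale lookup_single spectral_def
        rho_def when_def algebra_simps add_divide_distrib)
  then show ?thesis
    using below_index_geo_string[of 1 n] below_index_geo_string[of 2 n]
    by (simp add: G_def below_index_add below_index_scale)
qed

lemma below_index_cherednik_laurent:
  assumes "below_index m f" 
  shows "below_index m (cherednik_laurent k1 k2 f)"
  unfolding below_index_def
proof (intro allI impI)
  fix j assume j: "m \<le> expo_index j"
  have "Poly_Mapping.lookup (cherednik_monomial k1 k2 n) j = 0" if "n \<in> Poly_Mapping.keys f" for n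
  proof -
    have "expo_index n < m" using that assms by (auto simp: below_index_def in_keys_iff not_le[symmetric])
    then have "n \<noteq> j" "expo_index n \<le> expo_index j" using j by auto
    then show ?thesis
      using below_index_cherednik_monomial[of n k1 k2] by (auto simp: below_index_def lookup_minus lookup_single)
  qed
  then show "Poly_Mapping.lookup (cherednik_laurent k1 k2 f) j = 0"
    by (simp add: cherednik_laurent_def lookup_linear_extension)
qed

section \<open>The weight on the unit circle\<close>

text \<open>
  The convention \<open>0 powr 0 = 0\<close> would make the weight discontinuous at \<open>z = \<plusminus>1\<close> for vanishing parameters;
  this variant is continuous on the nonnegative reals for every \<open>k \<ge> 0\<close>.
\<close>

definition weight_power :: "real \<Rightarrow> real \<Rightarrow> real" where
  "weight_power y k = (if k = 0 then 1 else y powr k)"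

text \<open>
  The unit circle is parametrized by \<open>[0, 1]\<close>, as in \<open>circlepath\<close>.
\<close>

definition circ :: "real \<Rightarrow> complex" where
  "circ x = cis (2 * pi * x)"

definition circle_weight :: "real \<Rightarrow> real \<Rightarrow> real \<Rightarrow> real" where
  "circle_weight k1 k2 x = weight_power (1 - cos (2 * pi * x)) k1 * weight_power (1 - cos (4 * pi * x)) k2"

text \<open>
  The parameters of \<open>z = \<plusminus>1\<close>, where the weight may vanish and the coefficients of the Cherednik operator
  have their poles.
\<close>

definition critical_params :: "real set" where
  "critical_params = {0, 1/2, 1}"

lemma weight_power_nonneg: "weight_power y k \<ge> 0"
  by (simp add: weight_power_def)

lemma weight_power_pos: "y > 0 \<Longrightarrow> weight_power y k > 0"
  by (simp add: weight_power_def)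

lemma continuous_on_weight_power:
  assumes "continuous_on S f" "\<And>x. x \<in> S \<Longrightarrow> f x \<ge> 0" "k \<ge> 0"
  shows "continuous_on S (\<lambda>x. weight_power (f x) k)"
  unfolding weight_power_def using assms by (cases "k = 0") (auto intro!: continuous_on_powr')

lemma has_real_derivative_weight_power:
  assumes "y > 0"
  shows "((\<lambda>y. weight_power y k) has_real_derivative (k * weight_power y k / y)) (at y)"
proof (cases "k = 0")
  case False
  have "((\<lambda>y. y powr k) has_real_derivative (k * y powr (k - 1))) (at y)"
    using assms by (rule has_real_derivative_powr)
  then show ?thesis using False assms by (simp add: weight_power_def powr_diff)
qed (simp add: weight_power_def)

lemma continuous_on_circle_weight:
  assumes "k1 \<ge> 0" "k2 \<ge> 0"
  shows "continuous_on S (circle_weight k1 k2)"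
  unfolding circle_weight_def using assms
  by (intro continuous_intros continuous_on_weight_power) auto

lemma circle_weight_nonneg: "circle_weight k1 k2 x \<ge> 0"
  by (simp add: circle_weight_def weight_power_nonneg)

lemma cos_less_1_off_critical:
  assumes "x \<in> {0..1} - critical_params"
  shows "cos (2 * pi * x) < 1" "cos (4 * pi * x) < 1"
proof -
  have ne: "cos (2 * pi * x) \<noteq> 1" if "x \<in> {0<..<2}" "x \<noteq> 1" for x
  proof
    assume "cos (2 * pi * x) = 1"
    then obtain n :: int where "2 * pi * x = of_int n * 2 * pi" by (auto simp: cos_one_2pi_int)
    then have "x = of_int n" by simp
    then show False using that by auto
  qed
  have "cos (2 * pi * x) \<noteq> 1" "cos (2 * pi * (2 * x)) \<noteq> 1"
    by (rule ne; use assms in \<open>auto simp: critical_params_def\<close>)+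
  moreover have "2 * pi * (2 * x) = 4 * pi * x" by simp
  ultimately have "cos (2 * pi * x) \<noteq> 1" "cos (4 * pi * x) \<noteq> 1" by metis+
  then show "cos (2 * pi * x) < 1" "cos (4 * pi * x) < 1"
    using cos_le_one[of "2 * pi * x"] cos_le_one[of "4 * pi * x"] by (auto simp: less_le)
qed

lemma circle_weight_pos: "x \<in> {0..1} - critical_params \<Longrightarrow> circle_weight k1 k2 x > 0"
  using cos_less_1_off_critical[of x] by (simp add: circle_weight_def weight_power_pos)

lemma circle_weight_reflect: "circle_weight k1 k2 (1 - x) = circle_weight k1 k2 x"
proof -
  have "cos (2 * pi * (1 - x)) = cos (2 * pi * x)" "cos (4 * pi * (1 - x)) = cos (4 * pi * x)"
    using cos_periodic[of "- (2 * pi * x)"] cos_periodic[of "- (4 * pi * x)"]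
      cos_periodic[of "- (4 * pi * x) + 2 * pi"]
    by (simp_all add: algebra_simps)
  then show ?thesis by (simp add: circle_weight_def)
qed

lemma circle_weight_derivative:
  assumes "x \<in> {0..1} - critical_params"
  shows "(circle_weight k1 k2 has_real_derivative
    (2 * pi * (k1 * sin (2 * pi * x) / (1 - cos (2 * pi * x))
       + 2 * k2 * sin (4 * pi * x) / (1 - cos (4 * pi * x))) * circle_weight k1 k2 x)) (at x)"
proof -
  have c: "((\<lambda>x. 1 - cos (a * x)) has_real_derivative a * sin (a * x)) (at x)" for a
    by (auto intro!: derivative_eq_intros)
  have d: "((\<lambda>x. weight_power (1 - cos (a * x)) k) has_real_derivative
      k * weight_power (1 - cos (a * x)) k / (1 - cos (a * x)) * (a * sin (a * x))) (at x)"
    if "cos (a * x) < 1" for a k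
    by (rule DERIV_chain2[OF has_real_derivative_weight_power c]) (use that in simp)
  show ?thesis
    unfolding circle_weight_def
    by (rule DERIV_cong[OF DERIV_mult[OF d d]])
      (use cos_less_1_off_critical[OF assms] in \<open>simp_all add: field_simps\<close>)
qed

lemma circ_simps [simp]: "circ x \<noteq> 0" "inverse (circ x) = circ (- x)" "cnj (circ x) = circ (- x)"
  "circ (1 - x) = circ (- x)"
proof -
  have "circ (1 - x) = cis (2 * pi + - (2 * pi * x))" by (simp add: circ_def algebra_simps)
  also have "\<dots> = cis (2 * pi) * cis (- (2 * pi * x))" by (simp only: cis_mult)
  finally show "circ (1 - x) = circ (- x)" by (simp add: circ_def)
qed (simp_all add: circ_def cis_cnj)

lemma circ_squared: "circ x ^ 2 = cis (4 * pi * x)" "circ (2 * x) = cis (4 * pi * x)"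
  by (simp_all add: circ_def power2_eq_square cis_mult mult.assoc)

lemma cis_eq_1_iff_cos: "cis t = 1 \<longleftrightarrow> cos t = 1"
  by (auto simp: complex_eq_iff cos_one_sin_zero)

lemma circ_neq_1:
  assumes "x \<in> {0..1} - critical_params"
  shows "circ x \<noteq> 1" "circ x ^ 2 \<noteq> 1"
  using cos_less_1_off_critical[OF assms] unfolding circ_squared by (auto simp: circ_def cis_eq_1_iff_cos)

text \<open>
  The real part of \<open>(1 - e\<^sup>-\<^sup>i\<^sup>t)\<^sup>-\<^sup>1\<close> is constantly \<open>1/2\<close>, and its imaginary part is proportional to the logarithmic
  derivative \<open>sin t / (1 - cos t)\<close> of \<open>1 - cos t\<close>. This is what ties the Cherednik operator to the weight.
\<close>

lemma inverse_one_minus_cis: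
  assumes "cos t < 1"
  shows "inverse (1 - cis (- t)) = 1 / 2 - \<i> * sin t / (2 * (1 - cos t))"
    and "inverse (1 - cis t) = 1 - inverse (1 - cis (- t))"
proof -
  have inv: "inverse (1 - cis (- t)) = 1 / 2 - \<i> * sin t / (2 * (1 - cos t))" if "cos t < 1" for t :: real
  proof (rule inverse_unique)
    have s: "sin t * sin t = (1 - cos t) * (1 + cos t)"
      using sin_cos_squared_add[of t] by (simp add: power2_eq_square algebra_simps)
    have "(1 - cis (- t)) * (1 / 2 - \<i> * sin t / (2 * (1 - cos t)))
       = of_real ((1 - cos t) / 2 + sin t * sin t / (2 * (1 - cos t))) 
         + \<i> * of_real (sin t / 2 - (1 - cos t) * sin t / (2 * (1 - cos t)))"
      by (simp add: complex_eq_iff algebra_simps)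
    also have "\<dots> = 1"
      unfolding s using that by (simp add: complex_eq_iff field_simps)
    finally show "(1 - cis (- t)) * (1 / 2 - \<i> * sin t / (2 * (1 - cos t))) = 1" .
  qed
  show "inverse (1 - cis (- t)) = 1 / 2 - \<i> * sin t / (2 * (1 - cos t))" by (rule inv[OF assms])
  show "inverse (1 - cis t) = 1 - inverse (1 - cis (- t))"
    using inv[of t] inv[of "- t"] assms by simp
qed

lemma jweight_circ:
  assumes x: "x \<in> {0..1} - critical_params" and k: "k1 \<ge> 0" "k2 \<ge> 0"
  shows "jweight k1 k2 (circ x) = of_real (circle_weight k1 k2 x)"
proof -
  have c: "1 - (circ x + inverse (circ x)) / 2 = of_real (1 - cos (2 * pi * x))" for x
    by (simp add: complex_eq_iff circ_def)
  have p: "of_real y powr of_real k = (of_real (weight_power y k) :: complex)" if "y > 0" for y k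
    using that by (simp add: weight_power_def powr_of_real)
  have "circ x ^ 2 + inverse (circ x) ^ 2 = circ (2 * x) + inverse (circ (2 * x))"
    by (simp add: circ_squared power_inverse del: circ_simps(2))
  then have c2: "1 - (circ x ^ 2 + inverse (circ x) ^ 2) / 2 = of_real (1 - cos (4 * pi * x))"
    using c[of "2 * x"] by (simp add: mult.assoc)
  show ?thesis
    using cos_less_1_off_critical[OF x] unfolding jweight_def circle_weight_def c c2 by (simp add: p del: of_real_diff)
qed

text \<open>
  The contour integrand differs from the continuous one only at \<open>z = \<plusminus>1\<close>.
\<close>

lemma jinner_eq_integral:
  assumes k: "k1 \<ge> 0" "k2 \<ge> 0"
  shows "jinner k1 k2 f g = integral {0..1} (\<lambda>x.
    2 * pi * (cnj (leval f (circ x)) * leval g (circ x)) * circle_weight k1 k2 x)"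
proof -
  have cp: "circlepath 0 1 x = circ x" for x
    by (simp add: circlepath circ_def cis_conv_exp algebra_simps)
  have vd: "vector_derivative (circlepath 0 1) (at x) = 2 * pi * \<i> * circ x" for x
    by (simp add: vector_derivative_circlepath circ_def cis_conv_exp algebra_simps)
  show ?thesis
    unfolding jinner_def contour_integral_integral cp vd
  proof (rule integral_spike[of critical_params])
    show "negligible critical_params" by (simp add: critical_params_def)
    show "2 * pi * (cnj (leval f (circ x)) * leval g (circ x)) * circle_weight k1 k2 x
      = cnj (leval f (circ x)) * leval g (circ x) * jweight k1 k2 (circ x) / (\<i> * circ x) * (2 * pi * \<i> * circ x)"
      if "x \<in> {0..1} - critical_params" for x
      by (simp add: jweight_circ[OF that k])
  qed
qed

lemma leval_circ: "leval f (circ x) = (\<Sum>n\<in>Poly_Mapping.keys f. Poly_Mapping.lookup f n * cis (2 * pi * of_int n * x))"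
  by (simp add: leval_def circ_def cis_power_int algebra_simps)

lemma continuous_on_leval_circ: "continuous_on S (\<lambda>x. leval f (circ x))"
  unfolding leval_circ by (intro continuous_intros)

lemma leval_circ_has_vector_derivative:
  "((\<lambda>x. leval f (circ (c * x))) has_vector_derivative c * (2 * pi * \<i> * leval (leuler f) (circ (c * x)))) (at x)"
proof -
  have D: "((\<lambda>x. cis (a * x)) has_vector_derivative a * \<i> * cis (a * x)) (at x)" for a
  proof -
    have "((\<lambda>z. exp (\<i> * of_real a * z)) has_field_derivative \<i> * of_real a * exp (\<i> * of_real a * of_real x)) (at (of_real x))"
      by (auto intro!: derivative_eq_intros)
    from has_vector_derivative_real_field[OF this] show ?thesis
      by (simp add: cis_conv_exp mult_ac)
  qed
  have "leval (leuler f) (circ (c * x))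
      = (\<Sum>n\<in>Poly_Mapping.keys f. Poly_Mapping.lookup f n * (of_int n * cis ((2 * pi * of_int n * c) * x)))"
    unfolding leuler_def leval.lev_linear_extension
    by (simp add: leval.lev_single) (simp add: circ_def cis_power_int algebra_simps)
  then have "c * (2 * pi * \<i> * leval (leuler f) (circ (c * x)))
      = (\<Sum>n\<in>Poly_Mapping.keys f. Poly_Mapping.lookup f n
          * ((2 * pi * of_int n * c) * \<i> * cis ((2 * pi * of_int n * c) * x)))"
    by (simp add: sum_distrib_left mult_ac)
  moreover have "(\<lambda>x. leval f (circ (c * x)))
      = (\<lambda>x. \<Sum>n\<in>Poly_Mapping.keys f. Poly_Mapping.lookup f n * cis ((2 * pi * of_int n * c) * x))"
    by (simp add: leval_circ mult.assoc)
  moreover have "((\<lambda>x. \<Sum>n\<in>Poly_Mapping.keys f. Poly_Mapping.lookup f n * cis ((2 * pi * of_int n * c) * x))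
      has_vector_derivative (\<Sum>n\<in>Poly_Mapping.keys f. Poly_Mapping.lookup f n
          * (of_real (2 * pi * of_int n * c) * \<i> * cis ((2 * pi * of_int n * c) * x)))) (at x)"
    by (intro has_vector_derivative_sum has_vector_derivative_mult_right D)
  ultimately show ?thesis by simp
qed

section \<open>The inner product and the symmetry of the Cherednik operator\<close>

lemma has_integral_reflect_unit:
  fixes f :: "real \<Rightarrow> 'a::banach"
  assumes "(f has_integral I) {0..1}"
  shows "((\<lambda>x. f (1 - x)) has_integral I) {0..1}"
proof -
  have "(\<lambda>x. - x + 1 :: real) ` {0..1} = {0..1}"
    by (auto intro!: image_eqI[where x = "1 - _"])
  then show ?thesis
    using has_integral_affinity[of f I 0 1 "-1" 1] assms by (simp add: image_image)
qed

lemma continuous_on_jinner_integrand: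
  assumes "k1 \<ge> 0" "k2 \<ge> 0"
  shows "continuous_on S (\<lambda>x. complex_of_real (2 * pi) * (cnj (leval f (circ x)) * leval g (circ x)) * circle_weight k1 k2 x)"
  using assms by (intro continuous_intros continuous_on_leval_circ continuous_on_circle_weight)

text \<open>
  For nonnegative parameters the weight is bounded and continuous, so all integrals below exist.
\<close>

locale nonneg_params =
  fixes k1 k2 :: real
  assumes k1: "k1 \<ge> 0" and k2: "k2 \<ge> 0"
begin

abbreviation W :: "real \<Rightarrow> real" where "W \<equiv> circle_weight k1 k2"

lemma has_integral_jinner:
  "((\<lambda>x. complex_of_real (2 * pi) * (cnj (leval f (circ x)) * leval g (circ x)) * W x)
     has_integral jinner k1 k2 f g) {0..1}"
  unfolding jinner_eq_integral[OF k1 k2]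
  by (intro integrable_integral integrable_continuous_interval continuous_on_jinner_integrand k1 k2)

lemma jinner_unique:
  assumes "((\<lambda>x. complex_of_real (2 * pi) * (cnj (leval f (circ x)) * leval g (circ x)) * W x)
     has_integral I) {0..1}"
  shows "jinner k1 k2 f g = I"
  using has_integral_unique[OF has_integral_jinner assms] .

lemma jinner_commute: "jinner k1 k2 g f = cnj (jinner k1 k2 f g)"
proof (rule jinner_unique)
  show "((\<lambda>x. complex_of_real (2 * pi) * (cnj (leval g (circ x)) * leval f (circ x)) * W x)
     has_integral cnj (jinner k1 k2 f g)) {0..1}"
    using has_integral_cnj[THEN iffD2, OF has_integral_jinner[of f g]]
    by (simp add: o_def mult_ac)
qed

lemma jinner_diff_right: "jinner k1 k2 f (g - g') = jinner k1 k2 f g - jinner k1 k2 f g'"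
  by (rule jinner_unique, rule has_integral_eq[OF _ has_integral_diff[OF has_integral_jinner has_integral_jinner]])
    (simp add: leval.lev_diff algebra_simps)

lemma jinner_scale_right: "jinner k1 k2 f (Poly_Mapping.single 0 c * g) = c * jinner k1 k2 f g"
  by (rule jinner_unique, rule has_integral_eq[OF _ has_integral_mult_right[OF has_integral_jinner, where c = c]])
    (simp only: leval.lev_scale, simp only: mult_ac)

lemma jinner_0_right: "jinner k1 k2 f 0 = 0"
  using jinner_diff_right[of f 0 0] by simp

lemma jinner_add_right: "jinner k1 k2 f (g + g') = jinner k1 k2 f g + jinner k1 k2 f g'"
  using jinner_diff_right[of f "g + g'" g'] by simp

lemma jinner_sum_right: "jinner k1 k2 f (sum F S) = (\<Sum>i\<in>S. jinner k1 k2 f (F i))"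
  by (induction S rule: infinite_finite_induct) (simp_all add: jinner_0_right jinner_add_right)

lemma jinner_diff_left: "jinner k1 k2 (f - f') g = jinner k1 k2 f g - jinner k1 k2 f' g"
  unfolding jinner_commute[where g = "f - f'" and f = g] jinner_commute[where g = f and f = g]
    jinner_commute[where g = f' and f = g]
  by (simp add: jinner_diff_right)

lemma cherednik_laurent_at_circ:
  assumes "x \<in> {0..1} - critical_params"
  shows "leval (cherednik_laurent k1 k2 f) (circ x) = leval (leuler f) (circ x)
    + (k1 * inverse (1 - circ (- x)) + 2 * k2 * inverse (1 - circ (- x) ^ 2))
      * (leval f (circ x) - leval f (circ (- x))) - rho k1 k2 * leval f (circ x)"
  using leval.lev_cherednik_laurent[of "circ x" k1 k2 f] circ_neq_1[OF assms] by simp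

text \<open>
  Let \<open>\<Phi> = L w\<close> be the integrand of the difference of the two sides, with weight \<open>w\<close>. The factors
  \<open>(1 - z\<^sup>-\<^sup>s)\<^sup>-\<^sup>1\<close> are singular against the weight, so integration by parts is not available termwise. The
  remedy is to symmetrize under \<open>z \<mapsto> z\<^sup>-\<^sup>1\<close>, which preserves the integral. The terms mixing \<open>f(z)\<close> with
  \<open>g(z\<^sup>-\<^sup>1)\<close> then cancel, and the sum \<open>\<Phi>(z) + \<Phi>(z\<^sup>-\<^sup>1)\<close> becomes, up to a constant, the derivative of
  \<open>H w\<close>, where \<open>H\<close> is the antisymmetrization of \<open>cnj f * g\<close>. As \<open>H w\<close> is continuous, differentiable away
  from \<open>z = \<plusminus>1\<close> and zero at both ends, its derivative integrates to 0.
\<close>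

lemma jinner_cherednik_symmetric: "jinner k1 k2 f (cherednik_laurent k1 k2 g) = jinner k1 k2 (cherednik_laurent k1 k2 f) g"
proof -
  define a a' b b' where "a x = cnj (leval f (circ x))" and "a' x = cnj (leval f (circ (- x)))"
    and "b x = leval g (circ x)" and "b' x = leval g (circ (- x))" for x
  define da da' db db' where "da x = cnj (leval (leuler f) (circ x))"
    and "da' x = cnj (leval (leuler f) (circ (- x)))"
    and "db x = leval (leuler g) (circ x)" and "db' x = leval (leuler g) (circ (- x))" for x
  define U V where "U x = inverse (1 - circ (- x))" and "V x = inverse (1 - circ (- x) ^ 2)" for x
  define r :: complex where "r = rho k1 k2"
  define K K' where "K x = k1 * U x + 2 * k2 * V x" and "K' x = k1 * (1 - U x) + 2 * k2 * (1 - V x)" for x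
  define L where "L x = cnj (leval f (circ x)) * leval (cherednik_laurent k1 k2 g) (circ x)
      - cnj (leval (cherednik_laurent k1 k2 f) (circ x)) * leval g (circ x)" for x
  define H where "H x = a x * b x - a' x * b' x" for x
  define I where "I = jinner k1 k2 f (cherednik_laurent k1 k2 g) - jinner k1 k2 (cherednik_laurent k1 k2 f) g"
  have int_L: "((\<lambda>x. 2 * pi * L x * W x) has_integral I) {0..1}"
    unfolding I_def
    by (rule has_integral_eq[OF _ has_integral_diff[OF has_integral_jinner has_integral_jinner]])
      (simp add: L_def algebra_simps)
  \<comment> \<open>complex conjugation and the flip \<open>z \<mapsto> 1/z\<close> agree on the circle, and both exchange \<open>U\<close> with
    \<open>1 - U\<close>; the last equation is the logarithmic derivative of the weight\<close>
  have U: "inverse (1 - circ x) = 1 - U x" "inverse (1 - circ x ^ 2) = 1 - V x"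
      "cnj (U x) = 1 - U x" "cnj (V x) = 1 - V x"
      "2 * pi * \<i> * (K x - K' x) = 2 * pi * (k1 * sin (2 * pi * x) / (1 - cos (2 * pi * x))
       + 2 * k2 * sin (4 * pi * x) / (1 - cos (4 * pi * x)))" if x: "x \<in> {0..1} - critical_params" for x
  proof -
    note c = cos_less_1_off_critical[OF x]
    show *: "inverse (1 - circ x) = 1 - U x" "inverse (1 - circ x ^ 2) = 1 - V x"
      using inverse_one_minus_cis(2)[OF c(1)] inverse_one_minus_cis(2)[OF c(2)]
      by (simp_all add: U_def V_def circ_squared) (simp_all add: circ_def)
    show "cnj (U x) = 1 - U x" "cnj (V x) = 1 - V x"
      unfolding *[symmetric] by (simp_all add: U_def V_def)
    have UV: "U x = 1 / 2 - \<i> * sin (2 * pi * x) / (2 * (1 - cos (2 * pi * x)))"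
      "V x = 1 / 2 - \<i> * sin (4 * pi * x) / (2 * (1 - cos (4 * pi * x)))"
      using inverse_one_minus_cis(1)[OF c(1)] inverse_one_minus_cis(1)[OF c(2)]
      by (simp_all add: U_def V_def circ_squared) (simp_all add: circ_def)
    define p q where "p = sin (2 * pi * x) / (1 - cos (2 * pi * x))"
      and "q = sin (4 * pi * x) / (1 - cos (4 * pi * x))"
    have e: "2 * (1 / 2 - \<i> * complex_of_real s / complex_of_real (2 * d)) - 1
        = - \<i> * complex_of_real (s / d)" for s d :: real
      by (cases "d = 0") (simp_all add: field_simps)
    have "K x - K' x = k1 * (2 * U x - 1) + 2 * k2 * (2 * V x - 1)"
      by (simp add: K_def K'_def algebra_simps)
    also have "\<dots> = - \<i> * of_real (k1 * p + 2 * k2 * q)"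
      unfolding UV e p_def[symmetric] q_def[symmetric] by (simp add: algebra_simps)
    finally have KS: "K x - K' x = - \<i> * of_real (k1 * p + 2 * k2 * q)" .
    show "2 * pi * \<i> * (K x - K' x) = 2 * pi * (k1 * sin (2 * pi * x) / (1 - cos (2 * pi * x))
       + 2 * k2 * sin (4 * pi * x) / (1 - cos (4 * pi * x)))"
    proof -
      have eq: "k1 * sin (2 * pi * x) / (1 - cos (2 * pi * x)) + 2 * k2 * sin (4 * pi * x) / (1 - cos (4 * pi * x))
          = k1 * p + 2 * k2 * q" by (simp add: p_def q_def)
      have "2 * pi * \<i> * (- \<i> * complex_of_real t) = complex_of_real (2 * pi * t)" for t
        by simp
      then show ?thesis unfolding KS eq .
    qed
  qed
  \<comment> \<open>symmetrization cancels the products of a value at \<open>z\<close> with a value at \<open>1/z\<close>, and the constant \<open>\<rho>\<close>\<close>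
  have LL: "L x + L (1 - x) = a x * db x - da x * b x + a' x * db' x - da' x * b' x + (K x - K' x) * H x"
    if x: "x \<in> {0..1} - critical_params" for x
  proof -
    have x': "1 - x \<in> {0..1} - critical_params" using x by (auto simp: critical_params_def)
    have cc: "circ (- (1 - x)) = circ x"
      using circ_simps(4)[of "- (x - 1)"] circ_simps(4)[of x] circ_simps(2)[of "1 - x"] circ_simps(2)[of "- x"]
      by (metis minus_minus)
    have 1: "leval (cherednik_laurent k1 k2 g) (circ x) = db x + K x * (b x - b' x) - r * b x"
      "leval (cherednik_laurent k1 k2 f) (circ x) = cnj (da x) + K x * (cnj (a x) - cnj (a' x)) - r * cnj (a x)"
      using cherednik_laurent_at_circ[OF x] by (simp_all add: a_def a'_def b_def b'_def da_def db_def K_def U_def V_def r_def)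
    have 2: "leval (cherednik_laurent k1 k2 g) (circ (1 - x)) = db' x + K' x * (b' x - b x) - r * b' x"
      "leval (cherednik_laurent k1 k2 f) (circ (1 - x)) = cnj (da' x) + K' x * (cnj (a' x) - cnj (a x)) - r * cnj (a' x)"
      using cherednik_laurent_at_circ[OF x'] unfolding cc
      by (simp_all add: a_def a'_def b_def b'_def da'_def db'_def K'_def U(1,2)[OF x] r_def)
    have "cnj (K x) = K' x" "cnj (K' x) = K x" "cnj r = r"
      by (simp_all add: K_def K'_def U(3,4)[OF x] r_def)
    moreover have "cnj (leval f (circ x)) = a x" "leval g (circ x) = b x"
      "cnj (leval f (circ (1 - x))) = a' x" "leval g (circ (1 - x)) = b' x"
      by (simp_all add: a_def a'_def b_def b'_def)
    ultimately show ?thesis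
      unfolding L_def 1 2 H_def by (simp add: algebra_simps)
  qed
  have der: "((\<lambda>x. H x * W x) has_vector_derivative 2 * pi * \<i> * ((L x + L (1 - x)) * W x)) (at x)"
    if x: "x \<in> {0<..<1} - critical_params" for x
  proof -
    note d = leval_circ_has_vector_derivative[of _ 1, simplified] leval_circ_has_vector_derivative[of _ "-1", simplified]
    have x': "x \<in> {0..1} - critical_params" using x by auto
    have ab: "(a has_vector_derivative - 2 * pi * \<i> * da x) (at x)" "(a' has_vector_derivative 2 * pi * \<i> * da' x) (at x)"
      "(b has_vector_derivative 2 * pi * \<i> * db x) (at x)" "(b' has_vector_derivative - 2 * pi * \<i> * db' x) (at x)"
      using has_vector_derivative_cnj[OF d(1)[of f x]] has_vector_derivative_cnj[OF d(2)[of f x]] d(1)[of g x] d(2)[of g x]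
      unfolding a_def a'_def b_def b'_def da_def da'_def db_def db'_def by simp_all
    have w: "((\<lambda>x. complex_of_real (W x)) has_vector_derivative 2 * pi * \<i> * (K x - K' x) * W x) (at x)"
      using has_vector_derivative_of_real[where 'a = complex, OF circle_weight_derivative[OF x', of k1 k2]]
      unfolding U(5)[OF x'] by simp
    have "(H has_vector_derivative 2 * pi * \<i> * (a x * db x - da x * b x + a' x * db' x - da' x * b' x)) (at x)"
      unfolding H_def
      using has_vector_derivative_diff[OF has_vector_derivative_mult[OF ab(1,3)] has_vector_derivative_mult[OF ab(2,4)]]
      by (simp add: algebra_simps)
    from has_vector_derivative_mult[OF this w] show ?thesis
      unfolding LL[OF x'] by (simp add: algebra_simps)
  qed
  have cont: "continuous_on {0..1} (\<lambda>x. H x * W x)"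
    unfolding H_def a_def a'_def b_def b'_def
    by (intro continuous_intros continuous_on_leval_circ continuous_on_circle_weight k1 k2
      continuous_on_compose2[OF continuous_on_leval_circ[of UNIV]]) auto
  have "circ 1 = 1" "circ (- 1) = 1" "circ 0 = 1"
    using circ_simps(4)[of 0] circ_simps(2)[of 1] by (simp_all add: circ_def)
  then have ends: "H 0 = 0" "H 1 = 0"
    by (simp_all add: H_def a_def a'_def b_def b'_def)
  have "((\<lambda>x. 2 * pi * \<i> * ((L x + L (1 - x)) * W x)) has_integral 0) {0..1}"
    using fundamental_theorem_of_calculus_interior_strong[of critical_params 0 1, OF _ _ der cont] ends
    by (simp add: critical_params_def)
  moreover have "((\<lambda>x. \<i> * (2 * pi * L x * W x + 2 * pi * L (1 - x) * W (1 - x))) has_integral \<i> * (I + I)) {0..1}"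
    by (intro has_integral_mult_right has_integral_add has_integral_reflect_unit[OF int_L] int_L)
  ultimately have "\<i> * (I + I) = 0"
    by (intro has_integral_unique[of _ "\<i> * (I + I)" "{0..1}" 0]) (simp_all add: circle_weight_reflect algebra_simps)
  then show ?thesis by (simp add: I_def flip: mult_2)
qed

text \<open>
  The weight is positive except at \<open>z = \<plusminus>1\<close>, so \<open>f\<close> vanishes at infinitely many points of the circle. After
  multiplication with a power of \<open>z\<close> it becomes a polynomial with infinitely many roots.
\<close>

lemma jinner_definite:
  assumes "jinner k1 k2 f f = 0"
  shows "f = 0"
proof -
  define F where "F x = 2 * pi * norm (leval f (circ x)) ^ 2 * W x" for x
  have cont: "continuous_on {0..1} F"
    unfolding F_def
    by (intro continuous_intros continuous_on_leval_circ continuous_on_circle_weight k1 k2)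
  have F: "2 * pi * (cnj (leval f (circ x)) * leval f (circ x)) * W x = complex_of_real (F x)" for x
    unfolding F_def by (simp add: complex_norm_square mult_ac del: of_real_power)
  have "((\<lambda>x. complex_of_real (F x)) has_integral 0) {0..1}"
    using has_integral_jinner[of f f] assms unfolding F by simp
  from has_integral_linear[OF this bounded_linear_Re] have "(F has_integral 0) {0..1}"
    by (simp add: o_def)
  then have "integral {0..1} F = 0" by (rule integral_unique)
  moreover have "F x \<ge> 0" for x by (simp add: F_def circle_weight_nonneg)
  ultimately have F0: "\<forall>x\<in>{0..1}. F x = 0"
    using integral_eq_0_iff[OF cont] by simp
  have zero: "leval f (circ x) = 0" if "x \<in> {0<..<1/2}" for x
  proof -
    have "x \<in> {0..1} - critical_params" using that by (auto simp: critical_params_def)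
    then have "F x = 0" "W x > 0" using F0 circle_weight_pos by auto
    then show ?thesis by (simp add: F_def)
  qed
  have "inj_on circ {0<..<1/2}"
  proof (rule inj_onI)
    fix x y :: real assume xy: "x \<in> {0<..<1/2}" "y \<in> {0<..<1/2}" "circ x = circ y"
    then have "cos (2 * pi * x) = cos (2 * pi * y)" by (simp add: circ_def complex_eq_iff)
    moreover have "0 \<le> 2 * pi * t" "2 * pi * t \<le> pi" if "t \<in> {0<..<1/2}" for t :: real
      using that mult_left_mono[of "2 * t" 1 pi] by auto
    ultimately have "2 * pi * x = 2 * pi * y"
      using xy(1,2) cos_inj_pi by blast
    then show "x = y" by simp
  qed
  moreover have "infinite {0<..<1/2 :: real}" by (rule infinite_Ioo) simp
  ultimately have inf: "infinite (circ ` {0<..<1/2})"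
    using finite_imageD by blast
  \<comment> \<open>a shift that makes all exponents nonnegative\<close>
  define N where "N = Max (insert 0 (uminus ` Poly_Mapping.keys f))"
  have N: "n + N \<ge> 0" if "n \<in> Poly_Mapping.keys f" for n
  proof -
    have "- n \<le> N" unfolding N_def by (rule Max_ge) (use that in auto)
    then show ?thesis by simp
  qed
  define P where "P = (\<Sum>n\<in>Poly_Mapping.keys f. monom (Poly_Mapping.lookup f n) (nat (n + N)))"
  have P: "poly P z = z powi N * leval f z" if "z \<noteq> 0" for z
  proof -
    have "z ^ nat (n + N) = z powi N * z powi n" if "n \<in> Poly_Mapping.keys f" for n
    proof -
      have "z ^ nat (n + N) = z powi (N + n)"
        using N[OF that] by (simp add: power_int_def add.commute)
      then show ?thesis using \<open>z \<noteq> 0\<close> by (simp add: power_int_add)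
    qed
    then show ?thesis
      unfolding P_def leval_def poly_sum poly_monom sum_distrib_left
      by (intro sum.cong refl) (simp only: mult.left_commute)
  qed
  have "P = 0"
  proof (rule ccontr)
    assume "P \<noteq> 0"
    then have "finite {z. poly P z = 0}" by (rule poly_roots_finite)
    moreover have "circ ` {0<..<1/2} \<subseteq> {z. poly P z = 0}"
      using zero by (auto simp: P)
    ultimately show False using inf finite_subset by blast
  qed
  show "f = 0"
  proof (rule poly_mapping_eqI)
    fix m
    show "Poly_Mapping.lookup f m = Poly_Mapping.lookup 0 m"
    proof (cases "m \<in> Poly_Mapping.keys f")
      case True
      have "coeff P (nat (m + N)) = (\<Sum>n\<in>Poly_Mapping.keys f. if n = m then Poly_Mapping.lookup f n else 0)"
        unfolding P_def coeff_sum
      proof (rule sum.cong[OF refl])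
        fix n assume "n \<in> Poly_Mapping.keys f"
        then have "nat (n + N) = nat (m + N) \<longleftrightarrow> n = m"
          using N[of n] N[of m] True by linarith
        then show "coeff (monom (Poly_Mapping.lookup f n) (nat (n + N))) (nat (m + N))
          = (if n = m then Poly_Mapping.lookup f n else 0)" by simp
      qed
      then show ?thesis using True \<open>P = 0\<close> by simp
    qed (simp add: in_keys_iff)
  qed
qed

lemma below_index_gram_schmidt:
  "below_index j (gram_schmidt k1 k2 j - Poly_Mapping.single (expo j) 1)"
proof (induction j rule: less_induct)
  case (less j)
  have "below_index j (gram_schmidt k1 k2 i)" if "i < j" for i
  proof -
    have "below_index j (Poly_Mapping.single (expo i) 1)"
      using below_index_mono[OF below_index_single[of "expo i"]] that by simp
    moreover have "below_index j (gram_schmidt k1 k2 i - Poly_Mapping.single (expo i) 1)"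
      using below_index_mono[OF less[OF that]] that by simp
    ultimately have "below_index j ((gram_schmidt k1 k2 i - Poly_Mapping.single (expo i) 1) + Poly_Mapping.single (expo i) 1)"
      by (intro below_index_add)
    then show ?thesis by simp
  qed
  then have "below_index j (\<Sum>i<j. Poly_Mapping.single 0
          (jinner k1 k2 (gram_schmidt k1 k2 i) (Poly_Mapping.single (expo j) 1)
           / jinner k1 k2 (gram_schmidt k1 k2 i) (gram_schmidt k1 k2 i))
        * gram_schmidt k1 k2 i)" (is "below_index j ?S")
    by (intro below_index_sum below_index_scale) simp
  then have "below_index j (Poly_Mapping.single (expo j) 1 - ?S - Poly_Mapping.single (expo j) 1)"
    by (simp add: below_index_def lookup_minus)
  then show ?case by (simp only: gram_schmidt.simps[of k1 k2 j])
qed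

lemma gram_schmidt_neq_0: "gram_schmidt k1 k2 j \<noteq> 0"
proof
  assume "gram_schmidt k1 k2 j = 0"
  then have "Poly_Mapping.lookup (gram_schmidt k1 k2 j - Poly_Mapping.single (expo j) 1) (expo j) = -1"
    by (simp add: lookup_minus)
  then show False using below_index_gram_schmidt[of j] by (simp add: below_index_def)
qed

lemma gram_schmidt_orthogonal:
  "i < j \<Longrightarrow> jinner k1 k2 (gram_schmidt k1 k2 i) (gram_schmidt k1 k2 j) = 0"
proof (induction j arbitrary: i rule: less_induct)
  case (less j)
  define E where "E = gram_schmidt k1 k2"
  define e where "e = Poly_Mapping.single (expo j) (1 :: complex)"
  have orth: "jinner k1 k2 (E i) (E l) = 0" if "l < j" "l \<noteq> i" for l
  proof (cases "i < l")
    case True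
    then show ?thesis using less.IH[OF that(1)] by (simp add: E_def)
  next
    case False
    then have "jinner k1 k2 (E l) (E i) = 0"
      using less.IH[OF less.prems, of l] that by (simp add: E_def)
    then show ?thesis by (subst jinner_commute) simp
  qed
  have "jinner k1 k2 (E i) (E j)
      = jinner k1 k2 (E i) e - (\<Sum>l<j. jinner k1 k2 (E l) e / jinner k1 k2 (E l) (E l) * jinner k1 k2 (E i) (E l))"
    unfolding E_def e_def
    by (subst (2) gram_schmidt.simps) (simp add: jinner_diff_right jinner_sum_right jinner_scale_right)
  also have "(\<Sum>l<j. jinner k1 k2 (E l) e / jinner k1 k2 (E l) (E l) * jinner k1 k2 (E i) (E l))
      = (\<Sum>l\<in>{i}. jinner k1 k2 (E l) e / jinner k1 k2 (E l) (E l) * jinner k1 k2 (E i) (E l))"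
    by (rule sum.mono_neutral_right) (use less.prems orth in auto)
  also have "\<dots> = jinner k1 k2 (E i) e"
    using jinner_definite[of "E i"] gram_schmidt_neq_0[of i] by (auto simp: E_def)
  finally show ?case by (simp add: E_def)
qed

text \<open>
  The earlier monomials and the earlier Gram-Schmidt vectors span the same space: subtracting the right
  multiple of the \<open>i\<close>-th vector removes the monomial of index \<open>i\<close>.
\<close>

lemma jinner_below_index_gram_schmidt:
  assumes "below_index i f" "i \<le> j"
  shows "jinner k1 k2 f (gram_schmidt k1 k2 j) = 0"
  using assms
proof (induction i arbitrary: f)
  case 0
  then have "f = 0" by (intro below_index_0)
  then show ?case by (simp add: jinner_commute[where g = 0] jinner_0_right)
next
  case (Suc i)
  define c where "c = Poly_Mapping.lookup f (expo i)"
  define f' where "f' = f - Poly_Mapping.single 0 c * gram_schmidt k1 k2 i"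
  have "below_index i f'"
    unfolding below_index_def
  proof (intro allI impI)
    fix m assume m: "i \<le> expo_index m"
    have g: "Poly_Mapping.lookup (gram_schmidt k1 k2 i) m = (1 when expo i = m)"
      using below_index_gram_schmidt[of i] m by (auto simp: below_index_def lookup_minus lookup_single)
    show "Poly_Mapping.lookup f' m = 0"
    proof (cases "m = expo i")
      case False
      then have "expo_index m \<noteq> i" by auto
      then show ?thesis using m Suc.prems False by (auto simp: f'_def below_index_def lookup_minus lookup_scale g)
    qed (use g in \<open>simp add: f'_def lookup_minus lookup_scale c_def\<close>)
  qed
  then have "jinner k1 k2 f' (gram_schmidt k1 k2 j) = 0" using Suc by simp
  moreover have "jinner k1 k2 (Poly_Mapping.single 0 c * gram_schmidt k1 k2 i) (gram_schmidt k1 k2 j) = 0"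
  proof -
    have "jinner k1 k2 (gram_schmidt k1 k2 j) (gram_schmidt k1 k2 i) = 0"
      using gram_schmidt_orthogonal[of i j] Suc.prems by (subst jinner_commute) simp
    then show ?thesis by (subst jinner_commute) (simp add: jinner_scale_right)
  qed
  ultimately show ?case by (simp add: f'_def jinner_diff_left)
qed

text \<open>
  The residue \<open>r\<close> is a combination of earlier monomials because the diagonal entry has been subtracted.
  Symmetry moves the operator onto \<open>r\<close>, where it stays among those monomials, and \<open>E\<close> is orthogonal to them.
\<close>

proposition cherednik_laurent_jacobi_E:
  "cherednik_laurent k1 k2 (jacobi_E k1 k2 n) = Poly_Mapping.single 0 (of_real (spectral k1 k2 n)) * jacobi_E k1 k2 n"
proof -
  define j where "j = expo_index n"
  define E where "E = gram_schmidt k1 k2 j"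
  define c :: complex where "c = of_real (spectral k1 k2 n)"
  define e where "e = Poly_Mapping.single n (1 :: complex)"
  define r where "r = cherednik_laurent k1 k2 E - Poly_Mapping.single 0 c * E"
  have Ee: "below_index j (E - e)" using below_index_gram_schmidt[of j] by (simp add: E_def e_def j_def)
  have "cherednik_laurent k1 k2 e = cherednik_monomial k1 k2 n"
    by (simp add: cherednik_laurent_def linear_extension_def e_def)
  then have "below_index j (cherednik_laurent k1 k2 e - Poly_Mapping.single 0 c * e)"
    using below_index_cherednik_monomial[of n k1 k2] by (simp add: e_def c_def j_def mult_single)
  moreover have "r = (cherednik_laurent k1 k2 e - Poly_Mapping.single 0 c * e)
      + (cherednik_laurent k1 k2 (E - e) - Poly_Mapping.single 0 c * (E - e))"
    using linear_extension_add[of "cherednik_monomial k1 k2" e "E - e"] by (simp add: r_def cherednik_laurent_def algebra_simps)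
  ultimately have r: "below_index j r"
    using Ee by (simp add: below_index_add below_index_diff below_index_scale below_index_cherednik_laurent)
  have "jinner k1 k2 r r = jinner k1 k2 r (cherednik_laurent k1 k2 E) - c * jinner k1 k2 r E"
    by (subst (2) r_def) (simp add: jinner_diff_right jinner_scale_right)
  also have "\<dots> = 0"
    using jinner_below_index_gram_schmidt[OF r] jinner_below_index_gram_schmidt[OF below_index_cherednik_laurent[OF r]]
    by (simp add: jinner_cherednik_symmetric E_def)
  finally have "r = 0" by (rule jinner_definite)
  then show ?thesis by (simp add: r_def E_def j_def c_def jacobi_E_def)
qed

end

section \<open>The commutant and its spectrum\<close>

lemma reflection_act_jacobi_E:
  assumes "0 \<le> k1" "0 \<le> k2"
  shows "reflection_act (cherednik k1 k2) (lrat (jacobi_E k1 k2 n) rZ)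
    = rconst (of_real (spectral k1 k2 n)) * lrat (jacobi_E k1 k2 n) rZ"
proof -
  interpret nonneg_params k1 k2 by standard fact+
  define E where "E = jacobi_E k1 k2 n"
  have "reflection_act (cherednik k1 k2) (lrat E rZ) = lrat (cherednik_laurent k1 k2 E) rZ"
    using lrat.lev_cherednik_laurent[OF rZ_neq_0 rZ_neq_1(2), of k1 k2 E]
    by (simp add: reflection_act_cherednik euler_lrat rflip_lrat cherednik_coeff_def u1_def u2_def)
  also have "\<dots> = rconst (of_real (spectral k1 k2 n)) * lrat E rZ"
    unfolding E_def cherednik_laurent_jacobi_E by (rule lrat.lev_scale)
  finally show ?thesis unfolding E_def .
qed

theorem corollary6p14:
  fixes k1 k2 :: real and D :: "diffop^2^2" and p :: "complex poly"
  assumes "0 \<le> k1" and "0 \<le> k2"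
    and "D \<in> D_ns k1 k2"
    and "p = gamma_ns k1 k2 D $ 1 $ 1"
  shows "D = beta_ns (Gamma_star (poly_op p (cherednik k1 k2))) \<and>
    (\<forall>n::int. mat_act D (jacobi_P k1 k2 n)
       = rconst (poly p (of_real (spectral k1 k2 n))) *s jacobi_P k1 k2 n)"
proof -
  obtain X where D: "D = beta_ns (Gamma_star X)" and "X * cherednik k1 k2 = cherednik k1 k2 * X"
    using assms(3) by (rule D_ns_imp_beta_ns)
  then obtain q where X: "X = poly_op q (cherednik k1 k2)"
    using commuting_cherednik_imp_poly_op by blast
  have "D $ 1 $ 1 = dpart X"
    unfolding D by (cases X) (simp add: beta_ns_Gamma_star)
  then have "p = q"
    using assms(4) by (simp add: gamma_ns_def X gamma_poly_op_cherednik)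
  with D X have D_eq: "D = beta_ns (Gamma_star (poly_op p (cherednik k1 k2)))" by simp
  have "mat_act D (jacobi_P k1 k2 n) = rconst (poly p (of_real (spectral k1 k2 n))) *s jacobi_P k1 k2 n" for n
  proof -
    define f where "f = lrat (jacobi_E k1 k2 n) rZ"
    have P: "jacobi_P k1 k2 n = vector [f, rflip f]"
      by (simp add: jacobi_P_def f_def rflip_lrat)
    have "reflection_act (poly_op p (cherednik k1 k2)) f
        = rconst (poly p (of_real (spectral k1 k2 n))) * f"
      unfolding f_def by (rule reflection_act_poly_op_eigen[OF reflection_act_jacobi_E[OF assms(1,2)]])
    then show ?thesis
      unfolding D_eq P mat_act_beta_ns by (simp add: vec_eq_iff forall_2)
  qed
  with D_eq show ?thesis by blast
qed

end
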